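(* Let $(A,\circ,[\cdot,\cdot])$ be a Gel'fand-Dorfman algebra and let $R=\mathbf{k}[\partial]A$ be the Lie conformal algebra corresponding to it. Let $r\in A\otimes A$ be skew-symmetric, also naturally regarded as an element of $R\otimes R$. Then $r\in R\otimes R$ is a solution of the conformal classical Yang-Baxter equation in $R$ if and only if $r$ is a solution of the Gel'fand-Dorfman Yang-Baxter equation in $A$.
   Context: Conventions: $\mathbf{k}$ is a field of characteristic $0$; vector spaces over $\mathbf{k}$ are finite-dimensional; $\otimes=\otimes_{\mathbf{k}}$; $\tau(a\otimes b)=b\otimes a$; $a\star b=a\circ b+b\circ a$. Skew-symmetric means $r+\tau r=0$. A Novikov algebra $(A,\circ)$ satisfies $(a\circ b)\circ c-a\circ(b\circ c)=(b\circ a)\circ c-b\circ(a\circ c)$ and $(a\circ b)\circ c=(a\circ c)\circ b$. A Gel'fand-Dorfman (GD) algebra $(A,\circ,[\cdot,\cdot])$ is a Novikov algebra $(A,\circ)$ and a Lie algebra $(A,[\cdot,\cdot])$ with $[a\circ b,c]-[a\circ c,b]+[a,b]\circ c-[a,c]\circ b-a\circ[b,c]=0$ for all $a,b,c$. The Gel'fand-Dorfman Yang-Baxter equation in $A$ for $r=\sum_\alpha x_\alpha\otimes y_\alpha\in A\otimes A$ is $\mathbf{N}(r)=\mathbf{C}(r)=0$, where $\mathbf{N}(r)=\sum_{\alpha,\beta}\big(x_\alpha\otimes x_\beta\otimes y_\alpha\circ y_\beta+x_\alpha\otimes y_\alpha\star x_\beta\otimes y_\beta+x_\alpha\circ x_\beta\otimes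 y_\beta\otimes y_\alpha\big)$, $\mathbf{C}(r)=\sum_{\alpha,\beta}\big([x_\alpha,x_\beta]\otimes y_\alpha\otimes y_\beta+x_\alpha\otimes[y_\alpha,x_\beta]\otimes y_\beta+x_\alpha\otimes x_\beta\otimes[y_\alpha,y_\beta]\big)$. A Lie conformal algebra is a $\mathbf{k}[\partial]$-module $R$ with a $\mathbf{k}$-bilinear map $[\cdot_\lambda\cdot]:R\times R\to R[\lambda]$ such that $[\partial a_\lambda b]=-\lambda[a_\lambda b]$, $[a_\lambda\partial b]=(\lambda+\partial)[a_\lambda b]$, $[a_\lambda b]=-[b_{-\lambda-\partial}a]$, $[a_\lambda[b_\mu c]]=[[a_\lambda b]_{\lambda+\mu}c]+[b_\mu[a_\lambda c]]$. The Lie conformal algebra corresponding to a GD algebra $(A,\circ,[\cdot,\cdot])$ is the free module $R=\mathbf{k}[\partial]A=\mathbf{k}[\partial]\otimes_{\mathbf{k}}A$ with $[a_\lambda b]=\partial(b\circ a)+\lambda(a\star b)+[a,b]$ for $a,b\in A$, extended by the first two identities. The conformal classical Yang-Baxter equation (CCYBE) in a Lie conformal algebra $R$ for $r=\sum_\alpha x_\alpha\otimes y_\alpha\in R\otimes R$ is $[[r,r]]\equiv0 \bmod (\partial^{\otimes^3})$ in $R\otimes R\otimes R$, where $\partial^{\otimes^3}=\partial\otimes\mathrm{id}\otimes\mathrm{id}+\mathrm{id}\otimes\partial\otimes\mathrm{id}+\mathrm{id}\otimes\mathrm{id}\otimes\partial$ (congruence modulo the image of this operator) and $$[[r,r]]=\sum_{\alpha,\beta}\Big([{x_\alpha}_\mu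 x_\beta]\otimes y_\alpha\otimes y_\beta|_{\mu=\mathrm{id}\otimes\partial\otimes\mathrm{id}}-x_\alpha\otimes[{x_\beta}_\mu y_\alpha]\otimes y_\beta|_{\mu=\mathrm{id}\otimes\mathrm{id}\otimes\partial}-x_\alpha\otimes x_\beta\otimes[{y_\beta}_\mu y_\alpha]|_{\mu=\mathrm{id}\otimes\partial\otimes\mathrm{id}}\Big);$$ here substituting an operator for $\mu$ in $\sum_n\mu^n w_n$ ($w_n\in R^{\otimes3}$) means applying the $n$-th power of the operator to $w_n$. *)

theory Defs
  imports "HOL-Library.Poly_Mapping" "HOL-Computational_Algebra.Polynomial"
begin

section \<open>Gel'fand--Dorfman algebras\<close>

locale fin_dim_space = vector_space scale
  for scale :: "'k::field_char_0 \<Rightarrow> 'a::ab_group_add \<Rightarrow> 'a" +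
  assumes fin_dim: "\<exists>Basis. finite_dimensional_vector_space scale Basis"

locale fin_dim_algebra = fin_dim_space scale
  for scale :: "'k::field_char_0 \<Rightarrow> 'a::ab_group_add \<Rightarrow> 'a" +
  fixes mult :: "'a \<Rightarrow> 'a \<Rightarrow> 'a"
  assumes linear_right: "Vector_Spaces.linear scale scale (\<lambda>b. mult a b)"
    and linear_left: "Vector_Spaces.linear scale scale (\<lambda>a. mult a b)"

locale novikov_algebra = fin_dim_algebra scale circ
  for scale :: "'k::field_char_0 \<Rightarrow> 'a::ab_group_add \<Rightarrow> 'a"
    and circ :: "'a \<Rightarrow> 'a \<Rightarrow> 'a" +
  assumes left_symmetric:
      "circ (circ a b) c - circ a (circ b c) = circ (circ b a) c - circ b (circ a c)"
    and right_commutative: "circ (circ a b) c = circ (circ a c) b"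

locale lie_algebra = fin_dim_algebra scale brk
  for scale :: "'k::field_char_0 \<Rightarrow> 'a::ab_group_add \<Rightarrow> 'a"
    and brk :: "'a \<Rightarrow> 'a \<Rightarrow> 'a" +
  assumes alternating: "brk a a = 0"
    and jacobi: "brk a (brk b c) + brk b (brk c a) + brk c (brk a b) = 0"

locale gd_algebra =
  novikov: novikov_algebra scale circ + lie: lie_algebra scale brk
  for scale :: "'k::field_char_0 \<Rightarrow> 'a::ab_group_add \<Rightarrow> 'a"
    and circ :: "'a \<Rightarrow> 'a \<Rightarrow> 'a"
    and brk :: "'a \<Rightarrow> 'a \<Rightarrow> 'a" +
  assumes compatible:
    "brk (circ a b) c - brk (circ a c) b + circ (brk a b) c - circ (brk a c) b
       - circ a (brk b c) = 0"

definition star :: "('a::ab_group_add \<Rightarrow> 'a \<Rightarrow> 'a) \<Rightarrow> 'a \<Rightarrow> 'a \<Rightarrow> 'a" where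
  "star circ a b = circ a b + circ b a"


section \<open>Tensor products\<close>

text \<open>
  For a vector space \<open>V\<close> (the whole type \<open>'v\<close> with scalar multiplication \<open>s\<close>), the spaces
  \<open>V \<otimes> V\<close> and \<open>V \<otimes> V \<otimes> V\<close> are the quotients of the free vector space on pairs, respectively
  triples, by the subspace spanned by the multilinearity relations.  Elements of the free vector
  space are finitely supported functions; elements of the tensor products are cosets, and
  \<open>tclass2 s f\<close>, \<open>tclass3 s f\<close> are the cosets of \<open>f\<close>.
\<close>

definition fscale :: "'k::field \<Rightarrow> ('x \<Rightarrow>\<^sub>0 'k) \<Rightarrow> ('x \<Rightarrow>\<^sub>0 'k)" where
  "fscale c = Poly_Mapping.map ((*) c)"

definition lin_ext :: "('x \<Rightarrow> ('y \<Rightarrow>\<^sub>0 'k::field)) \<Rightarrow> ('x \<Rightarrow>\<^sub>0 'k) \<Rightarrow> ('y \<Rightarrow>\<^sub>0 'k)" where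
  "lin_ext F f = (\<Sum>x \<in> Poly_Mapping.keys f. fscale (Poly_Mapping.lookup f x) (F x))"

definition pure2 :: "'v \<Rightarrow> 'v \<Rightarrow> (('v \<times> 'v) \<Rightarrow>\<^sub>0 'k::field)" where
  "pure2 a b = Poly_Mapping.single (a, b) 1"

definition pure3 :: "'v \<Rightarrow> 'v \<Rightarrow> 'v \<Rightarrow> (('v \<times> 'v \<times> 'v) \<Rightarrow>\<^sub>0 'k::field)" where
  "pure3 a b c = Poly_Mapping.single (a, b, c) 1"

definition null2 ::
  "('k::field \<Rightarrow> 'v::ab_group_add \<Rightarrow> 'v) \<Rightarrow> (('v \<times> 'v) \<Rightarrow>\<^sub>0 'k) set" where
  "null2 s = module.span fscale (
      {pure2 (a + a') b - pure2 a b - pure2 a' b | a a' b. True} \<union>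
      {pure2 a (b + b') - pure2 a b - pure2 a b' | a b b'. True} \<union>
      {pure2 (s k a) b - fscale k (pure2 a b) | k a b. True} \<union>
      {pure2 a (s k b) - fscale k (pure2 a b) | k a b. True})"

definition null3 ::
  "('k::field \<Rightarrow> 'v::ab_group_add \<Rightarrow> 'v) \<Rightarrow> (('v \<times> 'v \<times> 'v) \<Rightarrow>\<^sub>0 'k) set" where
  "null3 s = module.span fscale (
      {pure3 (a + a') b c - pure3 a b c - pure3 a' b c | a a' b c. True} \<union>
      {pure3 a (b + b') c - pure3 a b c - pure3 a b' c | a b b' c. True} \<union>
      {pure3 a b (c + c') - pure3 a b c - pure3 a b c' | a b c c'. True} \<union>
      {pure3 (s k a) b c - fscale k (pure3 a b c) | k a b c. True} \<union>
      {pure3 a (s k b) c - fscale k (pure3 a b c) | k a b c. True} \<union>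
      {pure3 a b (s k c) - fscale k (pure3 a b c) | k a b c. True})"

definition tclass2 ::
  "('k::field \<Rightarrow> 'v::ab_group_add \<Rightarrow> 'v) \<Rightarrow> (('v \<times> 'v) \<Rightarrow>\<^sub>0 'k) \<Rightarrow> (('v \<times> 'v) \<Rightarrow>\<^sub>0 'k) set" where
  "tclass2 s f = {g. g - f \<in> null2 s}"

definition tclass3 ::
  "('k::field \<Rightarrow> 'v::ab_group_add \<Rightarrow> 'v) \<Rightarrow> (('v \<times> 'v \<times> 'v) \<Rightarrow>\<^sub>0 'k) \<Rightarrow> (('v \<times> 'v \<times> 'v) \<Rightarrow>\<^sub>0 'k) set" where
  "tclass3 s f = {g. g - f \<in> null3 s}"

definition tensor2 ::
  "('k::field \<Rightarrow> 'v::ab_group_add \<Rightarrow> 'v) \<Rightarrow> (('v \<times> 'v) \<Rightarrow>\<^sub>0 'k) set set" where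
  "tensor2 s = range (tclass2 s)"

text \<open>
  The element \<open>\<Sum>\<^sub>\<alpha> x\<^sub>\<alpha> \<otimes> y\<^sub>\<alpha>\<close> of \<open>V \<otimes> V\<close> given by a list of pairs \<open>(x\<^sub>\<alpha>, y\<^sub>\<alpha>)\<close>.
  Every element of \<open>V \<otimes> V\<close> is of this form.
\<close>

definition tsum2 ::
  "('k::field \<Rightarrow> 'v::ab_group_add \<Rightarrow> 'v) \<Rightarrow> ('v \<times> 'v) list \<Rightarrow> (('v \<times> 'v) \<Rightarrow>\<^sub>0 'k) set" where
  "tsum2 s xs = tclass2 s (\<Sum>(x, y)\<leftarrow>xs. pure2 x y)"

definition tadd :: "('x \<Rightarrow>\<^sub>0 'k::field) set \<Rightarrow> ('x \<Rightarrow>\<^sub>0 'k) set \<Rightarrow> ('x \<Rightarrow>\<^sub>0 'k) set" where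
  "tadd r t = {f + g | f g. f \<in> r \<and> g \<in> t}"

definition twist :: "(('v \<times> 'v) \<Rightarrow>\<^sub>0 'k::field) set \<Rightarrow> (('v \<times> 'v) \<Rightarrow>\<^sub>0 'k) set" where
  "twist r = lin_ext (\<lambda>(a, b). pure2 b a) ` r"

definition skew_symmetric ::
  "('k::field \<Rightarrow> 'v::ab_group_add \<Rightarrow> 'v) \<Rightarrow> (('v \<times> 'v) \<Rightarrow>\<^sub>0 'k) set \<Rightarrow> bool" where
  "skew_symmetric s r \<longleftrightarrow> tadd r (twist r) = tclass2 s 0"


section \<open>The Gel'fand--Dorfman Yang--Baxter equation\<close>

definition gd_N ::
  "('a::ab_group_add \<Rightarrow> 'a \<Rightarrow> 'a) \<Rightarrow> ('a \<times> 'a) list \<Rightarrow> (('a \<times> 'a \<times> 'a) \<Rightarrow>\<^sub>0 'k::field)" where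
  "gd_N circ r = (\<Sum>(x\<^sub>\<alpha>, y\<^sub>\<alpha>)\<leftarrow>r. \<Sum>(x\<^sub>\<beta>, y\<^sub>\<beta>)\<leftarrow>r.
      pure3 x\<^sub>\<alpha> x\<^sub>\<beta> (circ y\<^sub>\<alpha> y\<^sub>\<beta>)
    + pure3 x\<^sub>\<alpha> (star circ y\<^sub>\<alpha> x\<^sub>\<beta>) y\<^sub>\<beta>
    + pure3 (circ x\<^sub>\<alpha> x\<^sub>\<beta>) y\<^sub>\<beta> y\<^sub>\<alpha>)"

definition gd_C ::
  "('a \<Rightarrow> 'a \<Rightarrow> 'a) \<Rightarrow> ('a \<times> 'a) list \<Rightarrow> (('a \<times> 'a \<times> 'a) \<Rightarrow>\<^sub>0 'k::field)" where
  "gd_C brk r = (\<Sum>(x\<^sub>\<alpha>, y\<^sub>\<alpha>)\<leftarrow>r. \<Sum>(x\<^sub>\<beta>, y\<^sub>\<beta>)\<leftarrow>r.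
      pure3 (brk x\<^sub>\<alpha> x\<^sub>\<beta>) y\<^sub>\<alpha> y\<^sub>\<beta>
    + pure3 x\<^sub>\<alpha> (brk y\<^sub>\<alpha> x\<^sub>\<beta>) y\<^sub>\<beta>
    + pure3 x\<^sub>\<alpha> x\<^sub>\<beta> (brk y\<^sub>\<alpha> y\<^sub>\<beta>))"

text \<open>
  As for the conformal equation below, the classes involved do not depend on the chosen
  presentation \<open>xs\<close> of \<open>r\<close>.
\<close>

definition gdybe ::
  "('k::field \<Rightarrow> 'a::ab_group_add \<Rightarrow> 'a) \<Rightarrow> ('a \<Rightarrow> 'a \<Rightarrow> 'a) \<Rightarrow> ('a \<Rightarrow> 'a \<Rightarrow> 'a)
    \<Rightarrow> (('a \<times> 'a) \<Rightarrow>\<^sub>0 'k) set \<Rightarrow> bool" where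
  "gdybe s circ brk r \<longleftrightarrow> (\<exists>xs. r = tsum2 s xs \<and>
      tclass3 s (gd_N circ xs) = tclass3 s 0 \<and> tclass3 s (gd_C brk xs) = tclass3 s 0)"


section \<open>The conformal classical Yang--Baxter equation\<close>

text \<open>
  A \<open>\<lambda>\<close>-bracket on \<open>R\<close> is a function \<open>lb\<close> with values in \<open>R[\<lambda>]\<close>, i.e. polynomials with coefficients
  in \<open>R\<close>; \<open>D\<close> is the action of \<open>\<partial>\<close> on \<open>R\<close>.
\<close>

definition D_slot2 :: "('r \<Rightarrow> 'r) \<Rightarrow> (('r \<times> 'r \<times> 'r) \<Rightarrow>\<^sub>0 'k::field) \<Rightarrow> (('r \<times> 'r \<times> 'r) \<Rightarrow>\<^sub>0 'k)" where
  "D_slot2 D = lin_ext (\<lambda>(a, b, c). pure3 a (D b) c)"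

definition D_slot3 :: "('r \<Rightarrow> 'r) \<Rightarrow> (('r \<times> 'r \<times> 'r) \<Rightarrow>\<^sub>0 'k::field) \<Rightarrow> (('r \<times> 'r \<times> 'r) \<Rightarrow>\<^sub>0 'k)" where
  "D_slot3 D = lin_ext (\<lambda>(a, b, c). pure3 a b (D c))"

definition D_total :: "('r \<Rightarrow> 'r) \<Rightarrow> (('r \<times> 'r \<times> 'r) \<Rightarrow>\<^sub>0 'k::field) \<Rightarrow> (('r \<times> 'r \<times> 'r) \<Rightarrow>\<^sub>0 'k)" where
  "D_total D = lin_ext (\<lambda>(a, b, c). pure3 (D a) b c + pure3 a (D b) c + pure3 a b (D c))"

text \<open>
  For \<open>p = \<Sum>\<^sub>n \<mu>\<^sup>n p\<^sub>n \<in> R[\<mu>]\<close> and a linear map \<open>ins : R \<rightarrow> R \<otimes> R \<otimes> R\<close>, the result of substituting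
  the operator \<open>T\<close> for \<open>\<mu>\<close> in \<open>\<Sum>\<^sub>n \<mu>\<^sup>n ins(p\<^sub>n)\<close>.
\<close>

definition subst_mu ::
  "((('r \<times> 'r \<times> 'r) \<Rightarrow>\<^sub>0 'k::field) \<Rightarrow> (('r \<times> 'r \<times> 'r) \<Rightarrow>\<^sub>0 'k)) \<Rightarrow>
    ('r \<Rightarrow> (('r \<times> 'r \<times> 'r) \<Rightarrow>\<^sub>0 'k)) \<Rightarrow> 'r::zero poly \<Rightarrow> (('r \<times> 'r \<times> 'r) \<Rightarrow>\<^sub>0 'k)" where
  "subst_mu T ins p = (\<Sum>n\<le>degree p. (T ^^ n) (ins (coeff p n)))"

definition double_bracket ::
  "('r::ab_group_add \<Rightarrow> 'r) \<Rightarrow> ('r \<Rightarrow> 'r \<Rightarrow> 'r poly) \<Rightarrow> ('r \<times> 'r) list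
    \<Rightarrow> (('r \<times> 'r \<times> 'r) \<Rightarrow>\<^sub>0 'k::field)" where
  "double_bracket D lb r = (\<Sum>(x\<^sub>\<alpha>, y\<^sub>\<alpha>)\<leftarrow>r. \<Sum>(x\<^sub>\<beta>, y\<^sub>\<beta>)\<leftarrow>r.
      subst_mu (D_slot2 D) (\<lambda>p. pure3 p y\<^sub>\<alpha> y\<^sub>\<beta>) (lb x\<^sub>\<alpha> x\<^sub>\<beta>)
    - subst_mu (D_slot3 D) (\<lambda>p. pure3 x\<^sub>\<alpha> p y\<^sub>\<beta>) (lb x\<^sub>\<beta> y\<^sub>\<alpha>)
    - subst_mu (D_slot2 D) (\<lambda>p. pure3 x\<^sub>\<alpha> x\<^sub>\<beta> p) (lb y\<^sub>\<beta> y\<^sub>\<alpha>))"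

definition ccybe ::
  "('k::field \<Rightarrow> 'r::ab_group_add \<Rightarrow> 'r) \<Rightarrow> ('r \<Rightarrow> 'r) \<Rightarrow> ('r \<Rightarrow> 'r \<Rightarrow> 'r poly)
    \<Rightarrow> (('r \<times> 'r) \<Rightarrow>\<^sub>0 'k) set \<Rightarrow> bool" where
  "ccybe s D lb r \<longleftrightarrow> (\<exists>xs. r = tsum2 s xs \<and>
      (\<exists>w. tclass3 s (double_bracket D lb xs) = tclass3 s (D_total D w)))"


section \<open>The Lie conformal algebra of a Gel'fand--Dorfman algebra\<close>

text \<open>
  The free module \<open>R = k[\<partial>] \<otimes> A\<close> is represented by the type \<open>'a poly\<close> of polynomials in \<open>\<partial>\<close> with
  coefficients in \<open>A\<close>: the coefficient of degree \<open>n\<close> of \<open>u\<close> is the component of \<open>u\<close> in \<open>\<partial>\<^sup>n A\<close>, and an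
  element \<open>a\<close> of \<open>A\<close> is the constant polynomial \<open>[:a:]\<close>.  Accordingly \<open>R[\<lambda>]\<close> is \<open>'a poly poly\<close>, the
  outer variable being \<open>\<lambda>\<close>.
\<close>

definition R_scale :: "('k \<Rightarrow> 'a::zero \<Rightarrow> 'a) \<Rightarrow> 'k \<Rightarrow> 'a poly \<Rightarrow> 'a poly" where
  "R_scale s c = map_poly (s c)"

definition R_del :: "'a::zero poly \<Rightarrow> 'a poly" where
  "R_del = pCons 0"

definition lam_op :: "'a::zero poly poly \<Rightarrow> 'a poly poly" where
  "lam_op = pCons 0"

definition del_op :: "'a::zero poly poly \<Rightarrow> 'a poly poly" where
  "del_op = map_poly R_del"

text \<open>\<open>[a\<^sub>\<lambda> b] = \<partial>(b \<circ> a) + \<lambda>(a \<star> b) + [a, b]\<close> for \<open>a\<close>, \<open>b\<close> in \<open>A\<close>\<close>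

definition gen_bracket ::
  "('a::ab_group_add \<Rightarrow> 'a \<Rightarrow> 'a) \<Rightarrow> ('a \<Rightarrow> 'a \<Rightarrow> 'a) \<Rightarrow> 'a \<Rightarrow> 'a \<Rightarrow> 'a poly poly" where
  "gen_bracket circ brk a b =
     [: R_del [:circ b a:] :] + lam_op [: [:star circ a b:] :] + [: [:brk a b:] :]"

text \<open>\<open>[\<partial>\<^sup>i a\<^sub>\<lambda> \<partial>\<^sup>j b] = (-\<lambda>)\<^sup>i (\<lambda> + \<partial>)\<^sup>j [a\<^sub>\<lambda> b]\<close>, extended additively\<close>

definition R_bracket ::
  "('a::ab_group_add \<Rightarrow> 'a \<Rightarrow> 'a) \<Rightarrow> ('a \<Rightarrow> 'a \<Rightarrow> 'a) \<Rightarrow> 'a poly \<Rightarrow> 'a poly \<Rightarrow> 'a poly poly" where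
  "R_bracket circ brk u v = (\<Sum>i\<le>degree u. \<Sum>j\<le>degree v.
     ((\<lambda>w. - lam_op w) ^^ i)
       (((\<lambda>w. lam_op w + del_op w) ^^ j) (gen_bracket circ brk (coeff u i) (coeff v j))))"

definition R_embed2 ::
  "('k::field \<Rightarrow> 'a::ab_group_add \<Rightarrow> 'a) \<Rightarrow> (('a \<times> 'a) \<Rightarrow>\<^sub>0 'k) set
    \<Rightarrow> (('a poly \<times> 'a poly) \<Rightarrow>\<^sub>0 'k) set" where
  "R_embed2 s r = (\<Union>f\<in>r. tclass2 (R_scale s) (lin_ext (\<lambda>(a, b). pure2 [:a:] [:b:]) f))"


section \<open>Basic facts\<close>

lemma lookup_fscale: "Poly_Mapping.lookup (fscale c f) x = c * Poly_Mapping.lookup f x"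
  by (simp add: fscale_def Poly_Mapping.map.rep_eq when_def)

lemma vector_space_fscale: "vector_space (fscale :: 'k::field \<Rightarrow> ('x \<Rightarrow>\<^sub>0 'k) \<Rightarrow> _)"
  by unfold_locales
    (auto intro!: poly_mapping_eqI simp: lookup_fscale lookup_add algebra_simps)

lemma (in fin_dim_space) vector_space_R_scale: "vector_space (R_scale scale)"
  by unfold_locales
    (auto intro!: poly_eqI simp: R_scale_def coeff_map_poly scale_right_distrib scale_left_distrib)

context gd_algebra
begin

lemma gen_bracket_0: "gen_bracket circ brk 0 b = 0" "gen_bracket circ brk a 0 = 0"
proof -
  have "circ 0 b = 0" "circ a 0 = 0" "circ b 0 = 0" "circ 0 a = 0" "brk 0 b = 0" "brk a 0 = 0" for a b
    using novikov.linear_left novikov.linear_right lie.linear_left lie.linear_right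
    by (meson Vector_Spaces.linear_iff module_hom.zero Vector_Spaces.linear_def)+
  then show "gen_bracket circ brk 0 b = 0" "gen_bracket circ brk a 0 = 0"
    by (simp_all add: gen_bracket_def star_def R_del_def lam_op_def)
qed

lemma lam_op_0: "lam_op 0 = 0" and del_op_0: "del_op 0 = 0"
  by (simp_all add: lam_op_def del_op_def)

lemma lam_op_add: "lam_op (u + v) = lam_op u + lam_op v"
  for u v :: "'a poly poly"
  by (simp add: lam_op_def)

lemma del_op_add: "del_op (u + v) = del_op u + del_op v"
  for u v :: "'a poly poly"
  by (rule poly_eqI) (simp add: del_op_def coeff_map_poly R_del_def)

lemma iter_0: "h 0 = 0 \<Longrightarrow> (h ^^ n) 0 = 0"
  for h :: "'b::zero \<Rightarrow> 'b"
  by (induction n) auto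

lemma R_bracket_const: "R_bracket circ brk [:a:] [:b:] = gen_bracket circ brk a b"
  by (simp add: R_bracket_def)

lemma R_bracket_upto:
  assumes "degree u \<le> m" "degree v \<le> n"
  shows "R_bracket circ brk u v = (\<Sum>i\<le>m. \<Sum>j\<le>n.
     ((\<lambda>w. - lam_op w) ^^ i)
       (((\<lambda>w. lam_op w + del_op w) ^^ j) (gen_bracket circ brk (coeff u i) (coeff v j))))"
  (is "_ = (\<Sum>i\<le>m. \<Sum>j\<le>n. ?t i j)")
proof -
  have z: "?t i j = 0" if "degree u < i \<or> degree v < j" for i j
    using that by (auto simp: coeff_eq_0 gen_bracket_0 iter_0 lam_op_0 del_op_0)
  have "(\<Sum>i\<le>degree u. \<Sum>j\<le>degree v. ?t i j) = (\<Sum>i\<le>degree u. \<Sum>j\<le>n. ?t i j)"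
    using assms z by (intro sum.cong sum.mono_neutral_left) auto
  also have "\<dots> = (\<Sum>i\<le>m. \<Sum>j\<le>n. ?t i j)"
    using assms z by (intro sum.mono_neutral_left) (auto intro!: sum.neutral)
  finally show ?thesis by (simp add: R_bracket_def)
qed

lemma sum_hom:
  assumes "\<And>u v :: 'b::ab_group_add. h (u + v) = h u + (h v :: 'b)"
  shows "h (\<Sum>i\<in>S. f i) = (\<Sum>i\<in>S. h (f i))"
proof -
  have "h 0 = 0" using assms[of 0 0] by simp
  then show ?thesis by (induction S rule: infinite_finite_induct) (auto simp: assms)
qed

lemma R_bracket_del_left:
  "R_bracket circ brk (R_del u) v = - lam_op (R_bracket circ brk u v)"
proof -
  have d: "degree (R_del u) \<le> Suc (degree u)" by (simp add: R_del_def)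
  show ?thesis
    unfolding R_bracket_upto[OF d order.refl] R_bracket_upto[OF order.refl order.refl, of u v]
    by (subst sum.atMost_Suc_shift)
      (simp add: R_del_def gen_bracket_0 iter_0 lam_op_0 del_op_0
        sum_hom[of "lam_op :: 'a poly poly \<Rightarrow> _", OF lam_op_add] sum_negf)
qed

lemma lam_del_commute: "lam_op (del_op u) = del_op (lam_op u)"
  for u :: "'a poly poly"
  by (rule poly_eqI)
     (simp add: lam_op_def del_op_def coeff_map_poly R_del_def coeff_pCons split: nat.split)

lemma R_bracket_del_right:
  "R_bracket circ brk u (R_del v) = lam_op (R_bracket circ brk u v) + del_op (R_bracket circ brk u v)"
proof -
  let ?h = "\<lambda>w :: 'a poly poly. lam_op w + del_op w"
  have h: "?h (u + v) = ?h u + ?h v" for u v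
    by (simp add: lam_op_add del_op_add algebra_simps)
  have del_minus: "del_op (- w) = - del_op w" for w :: "'a poly poly"
    by (rule poly_eqI) (simp add: del_op_def coeff_map_poly R_del_def)
  have c: "?h (- lam_op w) = - lam_op (?h w)" for w
    by (simp add: lam_op_add del_minus lam_del_commute) (simp add: lam_op_def)
  have ci: "((\<lambda>w. - lam_op w) ^^ i) (?h w) = ?h (((\<lambda>w. - lam_op w) ^^ i) w)" for i w
    by (induction i) (simp_all add: c)
  have d: "degree (R_del v) \<le> Suc (degree v)" by (simp add: R_del_def)
  have "R_bracket circ brk u (R_del v) = ?h (R_bracket circ brk u v)"
    unfolding R_bracket_upto[OF order.refl d] R_bracket_upto[OF order.refl order.refl, of u v]
      sum_hom[of ?h, OF h]
    by (subst sum.atMost_Suc_shift)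
      (simp add: R_del_def gen_bracket_0 iter_0 lam_op_0 del_op_0 ci)
  then show ?thesis .
qed

end

end

theory Submission
  imports Defs
begin

text \<open>
  Over a field, a tensor is zero if and only if every multilinear form vanishes on it, because a
  vector outside a subspace is separated from it by a linear form (\<open>span_iff_linear_forms\<close>).  All
  equations between cosets therefore become families of equations between scalars.  The
  Gel'fand--Dorfman equation says that the sums \<open>N_form\<close> and \<open>C_form\<close> vanish for every trilinear
  form on \<open>A\<close>, and the conformal equation says that \<open>[[r,r]]\<close> is killed by every trilinear form \<open>T\<close>
  on \<open>R\<close> that is invariant, i.e. \<open>T(\<partial>u,v,w) + T(u,\<partial>v,w) + T(u,v,\<partial>w) = 0\<close>
  (\<open>gdybe_iff\<close>, \<open>congruent_0_mod_D_total_iff\<close>).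

  For \<open>r\<close> over \<open>A\<close>, the bracket \<open>[a\<^sub>\<lambda> b]\<close> has degree at most one in \<open>\<lambda>\<close> and \<open>\<partial>\<close> together.  Invariance
  moves a derivative away from the first tensor factor, so \<open>T([[r,r]])\<close> only involves the forms
  \<open>T\<^sub>0(a,b,c) = T(a,b,c)\<close>, \<open>T\<^sub>2(a,b,c) = T(a,\<partial>b,c)\<close> and \<open>T\<^sub>3(a,b,c) = T(a,b,\<partial>c)\<close> on \<open>A\<close>.
  The Lie brackets contribute \<open>T\<^sub>0(C(r))\<close>, and the terms with a derivative in the third factor are
  \<open>-T\<^sub>3(N(r))\<close>.  For skew-symmetric \<open>r\<close> the terms with a derivative in the second factor are
  \<open>T\<^sub>2(\<sigma> N(r))\<close>, where \<open>\<sigma>\<close> exchanges the last two factors.  Hence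
  \<open>T([[r,r]]) = T\<^sub>0(C(r)) + T\<^sub>2(\<sigma> N(r)) - T\<^sub>3(N(r))\<close>, which is \<open>double_bracket_form_const\<close>.

  If \<open>N(r) = C(r) = 0\<close>, this is zero for all \<open>T\<close>.  Conversely, \<open>R\<^sup>\<otimes>\<^sup>3\<close> modulo the image of the total
  derivative is free over \<open>k[\<partial>\<^sub>2,\<partial>\<^sub>3]\<close> on \<open>A\<^sup>\<otimes>\<^sup>3\<close>, where \<open>\<partial>\<^sub>2\<close>, \<open>\<partial>\<^sub>3\<close> are \<open>\<partial>\<close> acting on the second and
  third factors.  Taking the coefficients of \<open>1\<close> and of \<open>\<partial>\<^sub>3\<close> turns any form \<open>t\<close> on \<open>A\<close> into
  invariant forms \<open>T\<close> on \<open>R\<close> for which the identity reads \<open>T([[r,r]]) = t(C(r))\<close> and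
  \<open>T([[r,r]]) = -t(N(r))\<close>.

  The conformal equation may be witnessed by a presentation of \<open>r\<close> by elements of \<open>R\<close> that do not
  lie in \<open>A\<close>.  The identity still applies, since \<open>T([[r,r]])\<close> does not depend on the presentation:
  it is a double sum of a function that is bilinear in each of the two pairs
  (\<open>bilinear_bracket_form\<close>, \<open>pair_sum2_cong_tsum2\<close>), by bilinearity of the \<open>\<lambda>\<close>-bracket.
\<close>


section \<open>Linear forms and membership in spans\<close>

abbreviation linear_form :: "('k::field \<Rightarrow> 'v::ab_group_add \<Rightarrow> 'v) \<Rightarrow> ('v \<Rightarrow> 'k) \<Rightarrow> bool" where
  "linear_form s h \<equiv> Vector_Spaces.linear s (*) h"

lemma vector_space_mult: "vector_space ((*) :: 'k::field \<Rightarrow> 'k \<Rightarrow> 'k)"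
  by unfold_locales (auto simp: algebra_simps)

lemma linear_formI:
  assumes "vector_space s" "\<And>a b. h (a + b) = h a + h b" "\<And>c a. h (s c a) = c * h a"
  shows "linear_form s h"
  using assms vector_space_mult by (simp add: Vector_Spaces.linear_iff)

context
  fixes s1 :: "'k::field \<Rightarrow> 'v::ab_group_add \<Rightarrow> 'v" and s2 :: "'k \<Rightarrow> 'w::ab_group_add \<Rightarrow> 'w" and h
  assumes h: "Vector_Spaces.linear s1 s2 h"
begin

lemma linear_hom: "module_hom s1 s2 h"
  using h by (simp add: Vector_Spaces.linear_def)

lemmas linear_0 = module_hom.zero[OF linear_hom]
  and linear_add = module_hom.add[OF linear_hom]
  and linear_diff = module_hom.diff[OF linear_hom]
  and linear_neg = module_hom.neg[OF linear_hom]
  and linear_scale = module_hom.scale[OF linear_hom]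
  and linear_sum = module_hom.sum[OF linear_hom]

end

context
  fixes s1 :: "'k::field \<Rightarrow> 'v::ab_group_add \<Rightarrow> 'v" and s2 :: "'k \<Rightarrow> 'w::ab_group_add \<Rightarrow> 'w"
begin

lemma linear_plus:
  assumes "Vector_Spaces.linear s1 s2 f" "Vector_Spaces.linear s1 s2 g"
  shows "Vector_Spaces.linear s1 s2 (\<lambda>x. f x + g x)"
proof -
  interpret vector_space_pair s1 s2
    using assms by (auto simp: vector_space_pair_def Vector_Spaces.linear_iff)
  show ?thesis using assms by (rule linear_compose_add)
qed

lemma linear_minus:
  assumes "Vector_Spaces.linear s1 s2 f" "Vector_Spaces.linear s1 s2 g"
  shows "Vector_Spaces.linear s1 s2 (\<lambda>x. f x - g x)"
proof -
  interpret vector_space_pair s1 s2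
    using assms by (auto simp: vector_space_pair_def Vector_Spaces.linear_iff)
  show ?thesis using assms by (rule linear_compose_sub)
qed

lemma linear_uminus:
  assumes "Vector_Spaces.linear s1 s2 f"
  shows "Vector_Spaces.linear s1 s2 (\<lambda>x. - f x)"
proof -
  interpret vector_space_pair s1 s2
    using assms by (auto simp: vector_space_pair_def Vector_Spaces.linear_iff)
  show ?thesis using assms by (rule linear_compose_neg)
qed

lemma linear_null:
  assumes "vector_space s1" "vector_space s2"
  shows "Vector_Spaces.linear s1 s2 (\<lambda>x. 0)"
proof -
  interpret vector_space_pair s1 s2
    using assms by (simp add: vector_space_pair_def)
  show ?thesis by (rule linear_zero)
qed

lemma linear_sum_list:
  assumes "vector_space s1" "vector_space s2" "\<And>z. Vector_Spaces.linear s1 s2 (\<lambda>x. f z x)"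
  shows "Vector_Spaces.linear s1 s2 (\<lambda>x. \<Sum>z\<leftarrow>zs. f z x)"
  using assms by (induction zs) (auto intro: linear_null linear_plus)

end

lemma linear_set_sum:
  assumes "vector_space s1" "vector_space s2" "\<And>i. i \<in> I \<Longrightarrow> Vector_Spaces.linear s1 s2 (f i)"
  shows "Vector_Spaces.linear s1 s2 (\<lambda>x. \<Sum>i\<in>I. f i x)"
proof -
  interpret vector_space_pair s1 s2
    using assms by (simp add: vector_space_pair_def)
  show ?thesis by (rule linear_compose_sum) (use assms in auto)
qed

lemma linear_comp:
  assumes "Vector_Spaces.linear s1 s2 f" "Vector_Spaces.linear s2 s3 g"
  shows "Vector_Spaces.linear s1 s3 (\<lambda>x. g (f x))"
  using assms by (auto simp: Vector_Spaces.linear_iff)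

lemma linear_funpow:
  assumes "vector_space s" "Vector_Spaces.linear s s D"
  shows "Vector_Spaces.linear s s (D ^^ n)"
  using assms by (induction n) (auto simp: Vector_Spaces.linear_iff)

text \<open>
  A vector outside \<open>span S\<close> is part of a basis that extends a basis of \<open>span S\<close>, so some linear
  form vanishes on \<open>S\<close> but not at that vector.
\<close>

lemma span_iff_linear_forms:
  fixes s :: "'k::field \<Rightarrow> 'v::ab_group_add \<Rightarrow> 'v"
  assumes "vector_space s"
  shows "f \<in> module.span s S \<longleftrightarrow> (\<forall>h. linear_form s h \<and> (\<forall>x\<in>S. h x = 0) \<longrightarrow> h f = 0)"
proof -
  interpret vector_space s by fact
  interpret vector_space_pair s "(*) :: 'k \<Rightarrow> 'k \<Rightarrow> 'k"
    using assms vector_space_mult by (simp add: vector_space_pair_def)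
  show ?thesis
  proof (intro iffI allI impI)
    fix h assume "f \<in> span S" "linear_form s h \<and> (\<forall>x\<in>S. h x = 0)"
    then show "h f = 0" using linear_eq_0_on_span[of h S f] by auto
  next
    assume forms: "\<forall>h. linear_form s h \<and> (\<forall>x\<in>S. h x = 0) \<longrightarrow> h f = 0"
    show "f \<in> span S"
    proof (rule ccontr)
      assume f: "f \<notin> span S"
      obtain B where B: "B \<subseteq> span S" "independent B" "span S \<subseteq> span B"
        using maximal_independent_subset .
      have fB: "f \<notin> span B" using f B span_minimal[OF B(1) subspace_span] by blast
      then have "independent (insert f B)" using B(2) by (rule independent_insertI)
      from linear_independent_extend[OF this, of "\<lambda>x. if x = f then 1 else 0"]
      obtain h where h: "linear_form s h" "\<forall>x\<in>insert f B. h x = (if x = f then 1 else 0)"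
        by auto
      have "\<forall>x\<in>B. h x = 0" using h(2) fB span_base by auto
      then have "h x = 0" if "x \<in> span S" for x
        using linear_eq_0_on_span[OF h(1), of B x] that B(3) by auto
      then have "\<forall>x\<in>S. h x = 0" using span_base by auto
      with forms h show False by auto
    qed
  qed
qed


section \<open>Linear forms on free vector spaces\<close>

text \<open>
  The linear form on the free vector space with the prescribed values on the basis.
\<close>

definition form_ext :: "('x \<Rightarrow> 'k::field) \<Rightarrow> ('x \<Rightarrow>\<^sub>0 'k) \<Rightarrow> 'k" where
  "form_ext T f = (\<Sum>x \<in> Poly_Mapping.keys f. Poly_Mapping.lookup f x * T x)"

lemma form_ext_superset:
  assumes "finite X" "Poly_Mapping.keys f \<subseteq> X"
  shows "form_ext T f = (\<Sum>x\<in>X. Poly_Mapping.lookup f x * T x)"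
  unfolding form_ext_def
  using assms by (intro sum.mono_neutral_left) (auto simp: in_keys_iff)

lemma linear_form_ext:
  fixes T :: "'x \<Rightarrow> 'k::field"
  shows "linear_form fscale (form_ext T)"
proof (rule linear_formI[OF vector_space_fscale])
  fix f g :: "'x \<Rightarrow>\<^sub>0 'k"
  let ?X = "Poly_Mapping.keys f \<union> Poly_Mapping.keys g"
  have "form_ext T h = (\<Sum>x\<in>?X. Poly_Mapping.lookup h x * T x)" if "h \<in> {f, g, f + g}" for h
    using that keys_add[of f g] by (intro form_ext_superset) auto
  then show "form_ext T (f + g) = form_ext T f + form_ext T g"
    by (simp add: lookup_add distrib_right sum.distrib)
next
  fix c and f :: "'x \<Rightarrow>\<^sub>0 'k"
  have "Poly_Mapping.keys (fscale c f) \<subseteq> Poly_Mapping.keys f"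
    by (auto simp: in_keys_iff lookup_fscale)
  then show "form_ext T (fscale c f) = c * form_ext T f"
    by (subst form_ext_superset[of "Poly_Mapping.keys f"])
       (simp_all add: form_ext_def lookup_fscale sum_distrib_left mult.assoc)
qed

lemmas form_ext_0 [simp] = linear_0[OF linear_form_ext]
  and form_ext_add = linear_add[OF linear_form_ext]
  and form_ext_diff = linear_diff[OF linear_form_ext]
  and form_ext_fscale = linear_scale[OF linear_form_ext]
  and form_ext_sum = linear_sum[OF linear_form_ext]

lemma form_ext_single: "form_ext T (Poly_Mapping.single x c) = c * T x"
  by (subst form_ext_superset[of "{x}"]) auto

lemma form_ext_pure2 [simp]: "form_ext T (pure2 a b) = T (a, b)"
  by (simp add: pure2_def form_ext_single)

lemma form_ext_pure3 [simp]: "form_ext T (pure3 a b c) = T (a, b, c)"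
  by (simp add: pure3_def form_ext_single)

lemma form_ext_sum_list: "form_ext T (\<Sum>z\<leftarrow>zs. f z) = (\<Sum>z\<leftarrow>zs. form_ext T (f z))"
  by (induction zs) (simp_all add: form_ext_add)

lemma form_ext_lin_ext: "form_ext T (lin_ext F f) = form_ext (\<lambda>x. form_ext T (F x)) f"
  by (simp add: lin_ext_def form_ext_sum form_ext_fscale) (simp add: form_ext_def)

lemma sum_single_lookup:
  "f = (\<Sum>x\<in>Poly_Mapping.keys f. fscale (Poly_Mapping.lookup f x) (Poly_Mapping.single x 1))"
  by (rule poly_mapping_eqI)
     (simp add: lookup_sum lookup_fscale lookup_single when_def in_keys_iff if_distrib
        cong: if_cong)

lemma linear_form_eq_form_ext:
  assumes "linear_form fscale h"
  shows "h f = form_ext (\<lambda>x. h (Poly_Mapping.single x 1)) f"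
proof -
  have "h f = h (\<Sum>x\<in>Poly_Mapping.keys f. fscale (Poly_Mapping.lookup f x) (Poly_Mapping.single x 1))"
    by (subst sum_single_lookup[of f]) (rule refl)
  then show ?thesis by (simp add: linear_sum[OF assms] linear_scale[OF assms] form_ext_def)
qed

lemma lin_ext_single:
  fixes F :: "'x \<Rightarrow> ('y \<Rightarrow>\<^sub>0 'k::field)"
  shows "lin_ext F (Poly_Mapping.single x 1) = F x"
proof -
  have "fscale 1 g = g" for g :: "'y \<Rightarrow>\<^sub>0 'k" by (rule poly_mapping_eqI) (simp add: lookup_fscale)
  then show ?thesis by (simp add: lin_ext_def)
qed

lemma span_iff_form_ext:
  "f \<in> module.span fscale S \<longleftrightarrow> (\<forall>T. (\<forall>g\<in>S. form_ext T g = 0) \<longrightarrow> form_ext T f = 0)"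
  unfolding span_iff_linear_forms[OF vector_space_fscale]
proof (intro iffI allI impI)
  fix T assume "\<forall>h. linear_form fscale h \<and> (\<forall>g\<in>S. h g = 0) \<longrightarrow> h f = 0" "\<forall>g\<in>S. form_ext T g = 0"
  then show "form_ext T f = 0" using linear_form_ext[of T] by simp
next
  fix h assume T: "\<forall>T. (\<forall>g\<in>S. form_ext T g = 0) \<longrightarrow> form_ext T f = 0"
    and h: "linear_form fscale h \<and> (\<forall>g\<in>S. h g = 0)"
  note eq = linear_form_eq_form_ext[OF conjunct1[OF h]]
  from h have "\<forall>g\<in>S. form_ext (\<lambda>x. h (Poly_Mapping.single x 1)) g = 0"
    unfolding eq[symmetric] by (rule conjunct2)
  then show "h f = 0"
    unfolding eq[of f] using T by blast
qed

lemma form_ext_vanishes_on_span: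
  "(\<forall>g \<in> module.span fscale S. form_ext T g = 0) \<longleftrightarrow> (\<forall>g\<in>S. form_ext T g = 0)"
proof
  interpret free: vector_space "fscale :: 'b \<Rightarrow> ('a \<Rightarrow>\<^sub>0 'b) \<Rightarrow> _"
    by (rule vector_space_fscale)
  assume "\<forall>g \<in> module.span fscale S. form_ext T g = 0"
  then show "\<forall>g\<in>S. form_ext T g = 0" using free.span_base by auto
next
  assume "\<forall>g\<in>S. form_ext T g = 0"
  then show "\<forall>g \<in> module.span fscale S. form_ext T g = 0" by (simp add: span_iff_form_ext)
qed


section \<open>Tensors are determined by multilinear forms\<close>

definition bilinear_form :: "('k::field \<Rightarrow> 'v::ab_group_add \<Rightarrow> 'v) \<Rightarrow> ('v \<Rightarrow> 'v \<Rightarrow> 'k) \<Rightarrow> bool" where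
  "bilinear_form s B \<longleftrightarrow> (\<forall>b. linear_form s (\<lambda>a. B a b)) \<and> (\<forall>a. linear_form s (B a))"

definition trilinear_form ::
  "('k::field \<Rightarrow> 'v::ab_group_add \<Rightarrow> 'v) \<Rightarrow> ('v \<Rightarrow> 'v \<Rightarrow> 'v \<Rightarrow> 'k) \<Rightarrow> bool" where
  "trilinear_form s T \<longleftrightarrow> (\<forall>b c. linear_form s (\<lambda>a. T a b c)) \<and>
     (\<forall>a c. linear_form s (\<lambda>b. T a b c)) \<and> (\<forall>a b. linear_form s (T a b))"

text \<open>
  Evaluating a form on the generators of \<open>null2\<close> gives exactly the equations that express
  bilinearity; similarly for \<open>null3\<close> and trilinearity.
\<close>

lemma null2_generators_iff:
  assumes "vector_space s"
  shows "(\<forall>g \<in> null2 s. form_ext T g = 0) \<longleftrightarrow> bilinear_form s (\<lambda>a b. T (a, b))"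
proof -
  let ?G = "{pure2 (a + a') b - pure2 a b - pure2 a' b | a a' b. True} \<union>
      {pure2 a (b + b') - pure2 a b - pure2 a b' | a b b'. True} \<union>
      {pure2 (s k a) b - fscale k (pure2 a b) | k a b. True} \<union>
      {pure2 a (s k b) - fscale k (pure2 a b) | k a b. True}"
  have ball: "(\<forall>g \<in> ?G. P g) \<longleftrightarrow>
      (\<forall>a a' b. P (pure2 (a + a') b - pure2 a b - pure2 a' b)) \<and>
      (\<forall>a b b'. P (pure2 a (b + b') - pure2 a b - pure2 a b')) \<and>
      (\<forall>k a b. P (pure2 (s k a) b - fscale k (pure2 a b))) \<and>
      (\<forall>k a b. P (pure2 a (s k b) - fscale k (pure2 a b)))" for P
    by (simp only: ball_Un conj_assoc) (intro arg_cong2[where f = "(\<and>)"]; blast)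
  have "(\<forall>g \<in> null2 s. form_ext T g = 0) \<longleftrightarrow> (\<forall>g \<in> ?G. form_ext T g = 0)"
    unfolding null2_def by (rule form_ext_vanishes_on_span)
  also have "\<dots> \<longleftrightarrow> bilinear_form s (\<lambda>a b. T (a, b))"
    unfolding ball form_ext_diff form_ext_fscale form_ext_pure2
    unfolding diff_diff_eq right_minus_eq
    using assms vector_space_mult
    by (auto simp: bilinear_form_def Vector_Spaces.linear_iff)
  finally show ?thesis .
qed

lemma null3_generators_iff:
  assumes "vector_space s"
  shows "(\<forall>g \<in> null3 s. form_ext T g = 0) \<longleftrightarrow> trilinear_form s (\<lambda>a b c. T (a, b, c))"
proof -
  let ?G = "{pure3 (a + a') b c - pure3 a b c - pure3 a' b c | a a' b c. True} \<union>
      {pure3 a (b + b') c - pure3 a b c - pure3 a b' c | a b b' c. True} \<union>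
      {pure3 a b (c + c') - pure3 a b c - pure3 a b c' | a b c c'. True} \<union>
      {pure3 (s k a) b c - fscale k (pure3 a b c) | k a b c. True} \<union>
      {pure3 a (s k b) c - fscale k (pure3 a b c) | k a b c. True} \<union>
      {pure3 a b (s k c) - fscale k (pure3 a b c) | k a b c. True}"
  have ball: "(\<forall>g \<in> ?G. P g) \<longleftrightarrow>
      (\<forall>a a' b c. P (pure3 (a + a') b c - pure3 a b c - pure3 a' b c)) \<and>
      (\<forall>a b b' c. P (pure3 a (b + b') c - pure3 a b c - pure3 a b' c)) \<and>
      (\<forall>a b c c'. P (pure3 a b (c + c') - pure3 a b c - pure3 a b c')) \<and>
      (\<forall>k a b c. P (pure3 (s k a) b c - fscale k (pure3 a b c))) \<and>
      (\<forall>k a b c. P (pure3 a (s k b) c - fscale k (pure3 a b c))) \<and>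
      (\<forall>k a b c. P (pure3 a b (s k c) - fscale k (pure3 a b c)))" for P
    by (simp only: ball_Un conj_assoc) (intro arg_cong2[where f = "(\<and>)"]; blast)
  have "(\<forall>g \<in> null3 s. form_ext T g = 0) \<longleftrightarrow> (\<forall>g \<in> ?G. form_ext T g = 0)"
    unfolding null3_def by (rule form_ext_vanishes_on_span)
  also have "\<dots> \<longleftrightarrow> trilinear_form s (\<lambda>a b c. T (a, b, c))"
    unfolding ball form_ext_diff form_ext_fscale form_ext_pure3
    unfolding diff_diff_eq right_minus_eq
    using assms vector_space_mult
    by (auto simp: trilinear_form_def Vector_Spaces.linear_iff)
  finally show ?thesis .
qed

lemma null2_iff:
  assumes "vector_space s"
  shows "f \<in> null2 s \<longleftrightarrow> (\<forall>B. bilinear_form s B \<longrightarrow> form_ext (\<lambda>(a, b). B a b) f = 0)"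
proof -
  have "f \<in> null2 s \<longleftrightarrow> (\<forall>T. (\<forall>g \<in> null2 s. form_ext T g = 0) \<longrightarrow> form_ext T f = 0)"
    unfolding null2_def form_ext_vanishes_on_span by (rule span_iff_form_ext)
  also have "\<dots> \<longleftrightarrow> (\<forall>T. bilinear_form s (\<lambda>a b. T (a, b)) \<longrightarrow> form_ext T f = 0)"
    by (simp only: null2_generators_iff[OF assms])
  also have "\<dots> \<longleftrightarrow> (\<forall>B. bilinear_form s B \<longrightarrow> form_ext (\<lambda>(a, b). B a b) f = 0)"
  proof (intro iffI allI impI)
    fix T assume "\<forall>B. bilinear_form s B \<longrightarrow> form_ext (\<lambda>(a, b). B a b) f = 0"
      and "bilinear_form s (\<lambda>a b. T (a, b))"
    moreover have "(\<lambda>(a, b). T (a, b)) = T" by auto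
    ultimately show "form_ext T f = 0" by metis
  qed simp
  finally show ?thesis .
qed

lemma null3_iff:
  assumes "vector_space s"
  shows "f \<in> null3 s \<longleftrightarrow> (\<forall>T. trilinear_form s T \<longrightarrow> form_ext (\<lambda>(a, b, c). T a b c) f = 0)"
proof -
  have "f \<in> null3 s \<longleftrightarrow> (\<forall>T. (\<forall>g \<in> null3 s. form_ext T g = 0) \<longrightarrow> form_ext T f = 0)"
    unfolding null3_def form_ext_vanishes_on_span by (rule span_iff_form_ext)
  also have "\<dots> \<longleftrightarrow> (\<forall>T. trilinear_form s (\<lambda>a b c. T (a, b, c)) \<longrightarrow> form_ext T f = 0)"
    by (simp only: null3_generators_iff[OF assms])
  also have "\<dots> \<longleftrightarrow> (\<forall>T. trilinear_form s T \<longrightarrow> form_ext (\<lambda>(a, b, c). T a b c) f = 0)"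
  proof (intro iffI allI impI)
    fix T assume "\<forall>T. trilinear_form s T \<longrightarrow> form_ext (\<lambda>(a, b, c). T a b c) f = 0"
      and "trilinear_form s (\<lambda>a b c. T (a, b, c))"
    moreover have "(\<lambda>(a, b, c). T (a, b, c)) = T" by auto
    ultimately show "form_ext T f = 0" by metis
  qed simp
  finally show ?thesis .
qed

lemma coset_eq_iff:
  fixes S :: "('x \<Rightarrow>\<^sub>0 'k::field) set"
  assumes "module.subspace fscale S"
  shows "{h. h - f \<in> S} = {h. h - g \<in> S} \<longleftrightarrow> f - g \<in> S"
proof -
  interpret free: vector_space "fscale :: 'k \<Rightarrow> ('x \<Rightarrow>\<^sub>0 'k) \<Rightarrow> _"
    by (rule vector_space_fscale)
  show ?thesis
  proof
    assume "{h. h - f \<in> S} = {h. h - g \<in> S}"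
    moreover have "f \<in> {h. h - f \<in> S}" using free.subspace_0[OF assms] by simp
    ultimately show "f - g \<in> S" by auto
  next
    assume fg: "f - g \<in> S"
    have "h - f \<in> S \<longleftrightarrow> h - g \<in> S" for h
      using free.subspace_add[OF assms fg, of "h - f"] free.subspace_diff[OF assms _ fg, of "h - g"]
      by auto
    then show "{h. h - f \<in> S} = {h. h - g \<in> S}" by simp
  qed
qed

lemma null2_subspace: "module.subspace fscale (null2 s)"
proof -
  interpret free: vector_space "fscale :: 'a \<Rightarrow> ('b \<times> 'b \<Rightarrow>\<^sub>0 'a) \<Rightarrow> _"
    by (rule vector_space_fscale)
  show ?thesis by (simp add: null2_def)
qed

lemma null3_subspace: "module.subspace fscale (null3 s)"
proof -
  interpret free: vector_space "fscale :: 'a \<Rightarrow> ('b \<times> 'b \<times> 'b \<Rightarrow>\<^sub>0 'a) \<Rightarrow> _"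
    by (rule vector_space_fscale)
  show ?thesis by (simp add: null3_def)
qed

lemma bilinear_form_comp:
  assumes "Vector_Spaces.linear s s' h" "bilinear_form s' B"
  shows "bilinear_form s (\<lambda>a b. B (h a) (h b))"
  using assms by (auto simp: bilinear_form_def Vector_Spaces.linear_iff)

lemma trilinear_form_comp:
  assumes "Vector_Spaces.linear s s' f" "Vector_Spaces.linear s s' g" "Vector_Spaces.linear s s' h"
    and "trilinear_form s' T"
  shows "trilinear_form s (\<lambda>a b c. T (f a) (g b) (h c))"
  using assms by (auto simp: trilinear_form_def Vector_Spaces.linear_iff)

lemma tclass2_eq_iff: "tclass2 s f = tclass2 s g \<longleftrightarrow> f - g \<in> null2 s"
  unfolding tclass2_def by (rule coset_eq_iff[OF null2_subspace])

lemma tclass3_eq_iff: "tclass3 s f = tclass3 s g \<longleftrightarrow> f - g \<in> null3 s"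
  unfolding tclass3_def by (rule coset_eq_iff[OF null3_subspace])

lemma tclass2_eq_iff_forms:
  assumes "vector_space s"
  shows "tclass2 s f = tclass2 s g \<longleftrightarrow>
    (\<forall>B. bilinear_form s B \<longrightarrow> form_ext (\<lambda>(a, b). B a b) f = form_ext (\<lambda>(a, b). B a b) g)"
  by (simp add: tclass2_eq_iff null2_iff[OF assms] form_ext_diff)

abbreviation pair_sum :: "('v \<times> 'v) list \<Rightarrow> ('v \<Rightarrow> 'v \<Rightarrow> 'w::monoid_add) \<Rightarrow> 'w" where
  "pair_sum xs B \<equiv> (\<Sum>(x, y)\<leftarrow>xs. B x y)"

lemma form_ext_pair_sum: "form_ext T (pair_sum xs F) = pair_sum xs (\<lambda>x y. form_ext T (F x y))"
  by (simp add: form_ext_sum_list split_def)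

lemma tsum2_eq_iff:
  assumes "vector_space s"
  shows "tsum2 s xs = tsum2 s ys \<longleftrightarrow> (\<forall>B. bilinear_form s B \<longrightarrow> pair_sum xs B = pair_sum ys B)"
  by (simp add: tsum2_def tclass2_eq_iff_forms[OF assms] form_ext_pair_sum)

text \<open>
  The coefficients of a finitely supported function can be absorbed into the first factors.
\<close>

lemma tensor2_eq_tsum2:
  assumes "vector_space s" and "r \<in> tensor2 s"
  obtains xs where "r = tsum2 s xs"
proof -
  from assms(2) obtain f where f: "r = tclass2 s f" by (auto simp: tensor2_def)
  obtain zs where zs: "set zs = Poly_Mapping.keys f" "distinct zs"
    using finite_distinct_list[of "Poly_Mapping.keys f"] by auto
  define xs where "xs = map (\<lambda>(a, b). (s (Poly_Mapping.lookup f (a, b)) a, b)) zs"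
  have "form_ext (\<lambda>(a, b). B a b) f = pair_sum xs B" if B: "bilinear_form s B" for B
  proof -
    have hom: "B (s c a) b = c * B a b" for a b c
      using B by (simp add: bilinear_form_def Vector_Spaces.linear_iff)
    show ?thesis
      unfolding form_ext_def zs(1)[symmetric] sum_list_distinct_conv_sum_set[OF zs(2), symmetric]
      by (simp add: xs_def comp_def split_def hom)
  qed
  then have "r = tsum2 s xs"
    by (simp add: f tsum2_def tclass2_eq_iff_forms[OF assms(1)] form_ext_pair_sum)
  then show ?thesis by (rule that)
qed


section \<open>Double sums over a presentation of a tensor\<close>

text \<open>
  The difference of the two sides is the value of \<open>B\<close> on \<open>r + \<tau>r\<close>.  Skew-symmetry enters the proof
  only through this sign rule.
\<close>

lemma pair_sum_skew:
  assumes s: "vector_space s" and skew: "skew_symmetric s (tsum2 s xs)" and B: "bilinear_form s B"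
  shows "pair_sum xs (\<lambda>x y. B y x) = - pair_sum xs B"
proof -
  interpret free: vector_space "fscale :: 'a \<Rightarrow> ('b \<times> 'b \<Rightarrow>\<^sub>0 'a) \<Rightarrow> _"
    by (rule vector_space_fscale)
  let ?f = "pair_sum xs pure2 :: ('b \<times> 'b) \<Rightarrow>\<^sub>0 'a"
  have "?f \<in> tsum2 s xs"
    using free.subspace_0[OF null2_subspace, of s] by (simp add: tsum2_def tclass2_def)
  then have "?f + lin_ext (\<lambda>(a, b). pure2 b a) ?f \<in> tadd (tsum2 s xs) (twist (tsum2 s xs))"
    unfolding tadd_def twist_def by blast
  then have "?f + lin_ext (\<lambda>(a, b). pure2 b a) ?f \<in> null2 s"
    using skew by (simp add: skew_symmetric_def tclass2_def)
  then have "form_ext (\<lambda>(a, b). B a b) (?f + lin_ext (\<lambda>(a, b). pure2 b a) ?f) = 0"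
    using B by (simp only: null2_iff[OF s])
  then have "pair_sum xs B + pair_sum xs (\<lambda>x y. B y x) = 0"
    by (simp add: form_ext_add form_ext_lin_ext form_ext_pair_sum)
  then show ?thesis by (simp add: eq_neg_iff_add_eq_0 add.commute)
qed

abbreviation pair_sum2 :: "('v \<times> 'v) list \<Rightarrow> ('v \<Rightarrow> 'v \<Rightarrow> 'v \<Rightarrow> 'v \<Rightarrow> 'w::monoid_add) \<Rightarrow> 'w" where
  "pair_sum2 xs F \<equiv> pair_sum xs (\<lambda>x y. pair_sum xs (\<lambda>x' y'. F x y x' y'))"

lemma pair_sum_add: "pair_sum xs (\<lambda>x y. F x y + G x y) = pair_sum xs F + pair_sum xs G"
  for F G :: "'v \<Rightarrow> 'v \<Rightarrow> 'w::comm_monoid_add"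
  by (simp add: split_def sum_list_addf)

lemma pair_sum_diff: "pair_sum xs (\<lambda>x y. F x y - G x y) = pair_sum xs F - pair_sum xs G"
  for F G :: "'v \<Rightarrow> 'v \<Rightarrow> 'w::ab_group_add"
  by (simp add: split_def sum_list_subtractf)

lemma pair_sum_minus: "pair_sum xs (\<lambda>x y. - F x y) = - pair_sum xs F"
  for F :: "'v \<Rightarrow> 'v \<Rightarrow> 'w::ab_group_add"
  by (simp add: split_def uminus_sum_list_map comp_def)

lemma pair_sum2_swap: "pair_sum2 xs (\<lambda>x y x' y'. F x' y' x y) = pair_sum2 xs F"
  for F :: "'v \<Rightarrow> 'v \<Rightarrow> 'v \<Rightarrow> 'v \<Rightarrow> 'w::comm_monoid_add"
proof -
  have "(\<Sum>p\<leftarrow>xs. \<Sum>q\<leftarrow>ys. g p q) = (\<Sum>q\<leftarrow>ys. \<Sum>p\<leftarrow>xs. g p q)" for g :: "'v \<times> 'v \<Rightarrow> 'v \<times> 'v \<Rightarrow> 'w" and ys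
    by (induction xs) (simp_all add: sum_list_addf)
  then show ?thesis unfolding split_def .
qed

text \<open>
  One may change the presentation first in the inner sum and then in the outer one, each time by
  bilinearity in the corresponding pair.
\<close>

lemma pair_sum2_cong_tsum2:
  assumes s: "vector_space s" and eq: "tsum2 s xs = tsum2 s ys"
    and F: "\<And>x' y'. bilinear_form s (\<lambda>x y. F x y x' y')" "\<And>x y. bilinear_form s (F x y)"
  shows "pair_sum2 xs F = pair_sum2 ys F"
proof -
  have B: "pair_sum xs B = pair_sum ys B" if "bilinear_form s B" for B
    using eq that by (simp add: tsum2_eq_iff[OF s])
  have "bilinear_form s (\<lambda>x y. pair_sum ys (F x y))"
    using F(1) s vector_space_mult
    by (auto simp: bilinear_form_def split_def intro!: linear_sum_list)
  then show ?thesis by (simp add: B F(2))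
qed


section \<open>Polynomials with coefficients in a vector space\<close>

lemma vector_space_R_scale:
  assumes "vector_space s"
  shows "vector_space (R_scale s)"
proof -
  interpret vector_space s by fact
  show ?thesis
    by unfold_locales (auto intro!: poly_eqI
      simp: R_scale_def coeff_map_poly scale_right_distrib scale_left_distrib)
qed

lemma scale_0:
  assumes "vector_space s"
  shows "s c 0 = 0"
proof -
  interpret vector_space s by fact
  show ?thesis by simp
qed

lemma coeff_R_scale:
  assumes "vector_space s"
  shows "coeff (R_scale s c u) n = s c (coeff u n)"
  by (simp add: R_scale_def coeff_map_poly scale_0[OF assms])

lemma linear_coeff:
  assumes "vector_space s"
  shows "Vector_Spaces.linear (R_scale s) s (\<lambda>u. coeff u n)"
  using assms vector_space_R_scale[OF assms]
  by (simp add: Vector_Spaces.linear_iff coeff_R_scale)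

text \<open>
  For maps on \<open>V[\<partial>]\<close> given by a sum over the coefficients up to the degree, the number of summands
  varies with the argument; linearity may be checked with a fixed bound instead.
\<close>

lemma linear_of_degree_bound:
  fixes f :: "'a::ab_group_add poly \<Rightarrow> 'w::ab_group_add"
  assumes "vector_space s"
    and lin: "\<And>m. Vector_Spaces.linear (R_scale s) s2 (g m)"
    and eq: "\<And>u m. degree u \<le> m \<Longrightarrow> f u = g m u"
  shows "Vector_Spaces.linear (R_scale s) s2 f"
proof -
  have "f (u + v) = f u + f v" for u v
  proof -
    let ?m = "max (degree u) (degree v)"
    have "f (u + v) = g ?m (u + v)" "f u = g ?m u" "f v = g ?m v"
      by (auto intro!: eq degree_add_le)
    then show ?thesis by (simp add: linear_add[OF lin])
  qed
  moreover have "f (R_scale s c u) = s2 c (f u)" for c u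
  proof -
    have "f (R_scale s c u) = g (degree u) (R_scale s c u)"
      by (intro eq degree_le) (simp add: coeff_R_scale[OF \<open>vector_space s\<close>] scale_0[OF \<open>vector_space s\<close>] coeff_eq_0)
    then show ?thesis by (simp add: linear_scale[OF lin] eq[OF order.refl, of u])
  qed
  ultimately show ?thesis using lin by (simp add: Vector_Spaces.linear_iff)
qed

lemma linear_const:
  assumes "vector_space s"
  shows "Vector_Spaces.linear s (R_scale s) (\<lambda>a. [:a:])"
  using assms vector_space_R_scale[OF assms]
  by (auto simp: Vector_Spaces.linear_iff coeff_R_scale coeff_pCons scale_0 intro!: poly_eqI split: nat.split)

lemma linear_R_del:
  assumes "vector_space s"
  shows "Vector_Spaces.linear (R_scale s) (R_scale s) R_del"
  using assms vector_space_R_scale[OF assms]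
  by (auto simp: Vector_Spaces.linear_iff coeff_R_scale coeff_pCons scale_0 R_del_def intro!: poly_eqI
      split: nat.split)

lemma linear_del_op:
  assumes "vector_space s"
  shows "Vector_Spaces.linear (R_scale (R_scale s)) (R_scale (R_scale s)) del_op"
proof -
  have R: "vector_space (R_scale s)" using assms by (rule vector_space_R_scale)
  have "coeff (del_op w) n = R_del (coeff w n)" for w :: "'b poly poly" and n
    by (simp add: del_op_def coeff_map_poly R_del_def)
  then show ?thesis
    using R vector_space_R_scale[OF R] linear_add[OF linear_R_del[OF assms]]
      linear_scale[OF linear_R_del[OF assms]]
    by (auto simp: Vector_Spaces.linear_iff coeff_R_scale intro!: poly_eqI)
qed

lemma R_embed2_tsum2:
  assumes "vector_space s"
  shows "R_embed2 s (tsum2 s xs) = tsum2 (R_scale s) (map (\<lambda>(x, y). ([:x:], [:y:])) xs)"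
proof -
  interpret free: vector_space "fscale :: 'a \<Rightarrow> ('b \<times> 'b \<Rightarrow>\<^sub>0 'a) \<Rightarrow> _"
    by (rule vector_space_fscale)
  let ?f = "pair_sum xs pure2 :: ('b \<times> 'b) \<Rightarrow>\<^sub>0 'a"
  have cls: "tclass2 (R_scale s) (lin_ext (\<lambda>(a, b). pure2 [:a:] [:b:]) g) =
      tsum2 (R_scale s) (map (\<lambda>(x, y). ([:x:], [:y:])) xs)" if "g \<in> tsum2 s xs" for g
  proof -
    have "g - ?f \<in> null2 s" using that by (simp add: tsum2_def tclass2_def)
    then have eq: "form_ext (\<lambda>(a, b). B a b) g = pair_sum xs B" if "bilinear_form s B" for B
      using that by (simp add: null2_iff[OF assms] form_ext_diff form_ext_pair_sum)
    have "bilinear_form s (\<lambda>a b. B [:a:] [:b:])" if "bilinear_form (R_scale s) B" for B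
      using bilinear_form_comp[OF linear_const[OF assms] that] .
    then have "form_ext (\<lambda>(a, b). B [:a:] [:b:]) g = pair_sum xs (\<lambda>a b. B [:a:] [:b:])"
      if "bilinear_form (R_scale s) B" for B
      using eq that by blast
    then show ?thesis
      unfolding tsum2_def tclass2_eq_iff_forms[OF vector_space_R_scale[OF assms]]
      by (simp add: form_ext_lin_ext form_ext_sum_list split_def comp_def)
  qed
  have "?f \<in> tsum2 s xs"
    using free.subspace_0[OF null2_subspace, of s] by (simp add: tsum2_def tclass2_def)
  then have "tsum2 s xs \<noteq> {}" by blast
  then show ?thesis unfolding R_embed2_def by (simp add: cls)
qed


section \<open>The Yang--Baxter equations in terms of trilinear forms\<close>

text \<open>
  The values of the trilinear form \<open>T\<close> on \<open>N(r)\<close> and \<open>C(r)\<close>, for \<open>r\<close> presented by \<open>xs\<close>.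
\<close>

definition N_form :: "('a::ab_group_add \<Rightarrow> 'a \<Rightarrow> 'a) \<Rightarrow> ('a \<Rightarrow> 'a \<Rightarrow> 'a \<Rightarrow> 'k::field) \<Rightarrow> ('a \<times> 'a) list \<Rightarrow> 'k"
  where "N_form circ T xs = pair_sum xs (\<lambda>x y. pair_sum xs (\<lambda>x' y'.
    T x x' (circ y y') + T x (star circ y x') y' + T (circ x x') y' y))"

definition C_form :: "('a \<Rightarrow> 'a \<Rightarrow> 'a) \<Rightarrow> ('a \<Rightarrow> 'a \<Rightarrow> 'a \<Rightarrow> 'k::field) \<Rightarrow> ('a \<times> 'a) list \<Rightarrow> 'k"
  where "C_form brk T xs = pair_sum xs (\<lambda>x y. pair_sum xs (\<lambda>x' y'.
    T (brk x x') y y' + T x (brk y x') y' + T x x' (brk y y')))"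

lemma gdybe_iff:
  assumes "vector_space s"
  shows "gdybe s circ brk r \<longleftrightarrow> (\<exists>xs. r = tsum2 s xs \<and>
    (\<forall>T. trilinear_form s T \<longrightarrow> N_form circ T xs = 0 \<and> C_form brk T xs = 0))"
proof -
  have "form_ext (\<lambda>(a, b, c). T a b c) (gd_N circ xs) = N_form circ T xs"
    "form_ext (\<lambda>(a, b, c). T a b c) (gd_C brk xs) = C_form brk T xs" for T :: "'b \<Rightarrow> 'b \<Rightarrow> 'b \<Rightarrow> 'a" and xs
    by (simp_all add: gd_N_def gd_C_def N_form_def C_form_def form_ext_pair_sum form_ext_add)
  then show ?thesis
    unfolding gdybe_def tclass3_eq_iff null3_iff[OF assms] by auto
qed

text \<open>
  The trilinear forms with this property are those that factor through the quotient of
  \<open>R \<otimes> R \<otimes> R\<close> by the image of \<open>\<partial> \<otimes> id \<otimes> id + id \<otimes> \<partial> \<otimes> id + id \<otimes> id \<otimes> \<partial>\<close>.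
\<close>

definition invariant_form :: "('r \<Rightarrow> 'r) \<Rightarrow> ('r \<Rightarrow> 'r \<Rightarrow> 'r \<Rightarrow> 'k::field) \<Rightarrow> bool" where
  "invariant_form D T \<longleftrightarrow> (\<forall>a b c. T (D a) b c + T a (D b) c + T a b (D c) = 0)"

lemma lookup_lin_ext:
  "Poly_Mapping.lookup (lin_ext F f) y = form_ext (\<lambda>x. Poly_Mapping.lookup (F x) y) f"
  by (simp add: lin_ext_def lookup_sum lookup_fscale form_ext_def)

lemma linear_lin_ext: "Vector_Spaces.linear fscale fscale (lin_ext F)"
  by (auto simp: Vector_Spaces.linear_iff vector_space_fscale lookup_lin_ext form_ext_add
    form_ext_fscale lookup_add lookup_fscale intro!: poly_mapping_eqI)

lemma form_ext_D_total:
  "form_ext T (D_total D w) =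
     form_ext (\<lambda>(a, b, c). T (D a, b, c) + T (a, D b, c) + T (a, b, D c)) w"
  unfolding D_total_def form_ext_lin_ext
  by (rule arg_cong[where f = "\<lambda>T. form_ext T w"]) (auto simp: form_ext_add)

text \<open>
  The elements congruent to zero form the sum of \<open>null3\<close> and the image of the total derivative;
  a form kills the first summand iff it is trilinear, and the second iff it is invariant.
\<close>

lemma congruent_0_mod_D_total_iff:
  assumes "vector_space s"
  shows "(\<exists>w. tclass3 s f = tclass3 s (D_total D w)) \<longleftrightarrow>
    (\<forall>T. trilinear_form s T \<and> invariant_form D T \<longrightarrow> form_ext (\<lambda>(a, b, c). T a b c) f = 0)"
proof -
  interpret free: vector_space "fscale :: 'a \<Rightarrow> ('b \<times> 'b \<times> 'b \<Rightarrow>\<^sub>0 'a) \<Rightarrow> _"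
    by (rule vector_space_fscale)
  let ?S = "{g + h |g h. g \<in> null3 s \<and> h \<in> range (D_total D)}"
  have sub: "free.subspace ?S"
  proof (rule free.subspace_sums[OF null3_subspace])
    show "free.subspace (range (D_total D))"
      unfolding D_total_def
      by (rule module_hom.subspace_image[OF linear_hom[OF linear_lin_ext] free.subspace_UNIV])
  qed
  have kills: "(\<forall>g\<in>?S. form_ext T g = 0) \<longleftrightarrow>
      trilinear_form s (\<lambda>a b c. T (a, b, c)) \<and> invariant_form D (\<lambda>a b c. T (a, b, c))" for T
  proof -
    have "(\<forall>w. form_ext T (D_total D w) = 0) \<longleftrightarrow> invariant_form D (\<lambda>a b c. T (a, b, c))"
    proof
      assume "\<forall>w. form_ext T (D_total D w) = 0"
      then have "form_ext T (D_total D (pure3 a b c)) = 0" for a b c by blast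
      then show "invariant_form D (\<lambda>a b c. T (a, b, c))"
        by (simp add: form_ext_D_total invariant_form_def)
    next
      assume "invariant_form D (\<lambda>a b c. T (a, b, c))"
      then have "(\<lambda>(a, b, c). T (D a, b, c) + T (a, D b, c) + T (a, b, D c)) = (\<lambda>_. 0)"
        by (auto simp: invariant_form_def)
      then show "\<forall>w. form_ext T (D_total D w) = 0"
        by (simp add: form_ext_D_total) (simp add: form_ext_def)
    qed
    moreover have "(\<forall>g\<in>?S. form_ext T g = 0) \<longleftrightarrow>
        (\<forall>g\<in>null3 s. form_ext T g = 0) \<and> (\<forall>w. form_ext T (D_total D w) = 0)"
    proof (intro iffI conjI ballI allI)
      assume S: "\<forall>g\<in>?S. form_ext T g = 0"
      have D0: "D_total D 0 = 0" by (simp add: D_total_def linear_0[OF linear_lin_ext])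
      show "form_ext T g = 0" if "g \<in> null3 s" for g
      proof -
        have "g + D_total D 0 \<in> ?S" using that by blast
        then have "form_ext T (g + D_total D 0) = 0" using S by blast
        then show ?thesis by (simp add: D0)
      qed
      show "form_ext T (D_total D w) = 0" for w
      proof -
        have "0 + D_total D w \<in> ?S" using free.subspace_0[OF null3_subspace, of s] by blast
        then have "form_ext T (0 + D_total D w) = 0" using S by blast
        then show ?thesis by simp
      qed
    qed (auto simp: form_ext_add)
    ultimately show ?thesis by (simp only: null3_generators_iff[OF assms])
  qed
  have "(\<exists>w. tclass3 s f = tclass3 s (D_total D w)) \<longleftrightarrow> f \<in> ?S"
    unfolding tclass3_eq_iff
  proof
    assume "\<exists>w. f - D_total D w \<in> null3 s"
    then obtain w where "f - D_total D w \<in> null3 s" ..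
    moreover have "f = (f - D_total D w) + D_total D w" by simp
    ultimately show "f \<in> ?S" by blast
  next
    assume "f \<in> ?S"
    then obtain g w where "g \<in> null3 s" "f - D_total D w = g" by auto
    then show "\<exists>w. f - D_total D w \<in> null3 s" by auto
  qed
  also have "\<dots> \<longleftrightarrow> f \<in> free.span ?S" by (simp only: free.span_eq_iff[THEN iffD2, OF sub])
  also have "\<dots> \<longleftrightarrow> (\<forall>T. trilinear_form s (\<lambda>a b c. T (a, b, c)) \<and>
      invariant_form D (\<lambda>a b c. T (a, b, c)) \<longrightarrow> form_ext T f = 0)"
    by (simp only: span_iff_form_ext kills)
  also have "\<dots> \<longleftrightarrow> (\<forall>T. trilinear_form s T \<and> invariant_form D T \<longrightarrow>
      form_ext (\<lambda>(a, b, c). T a b c) f = 0)"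
  proof (intro iffI allI impI)
    fix T assume "\<forall>T. trilinear_form s T \<and> invariant_form D T \<longrightarrow> form_ext (\<lambda>(a, b, c). T a b c) f = 0"
      and "trilinear_form s (\<lambda>a b c. T (a, b, c)) \<and> invariant_form D (\<lambda>a b c. T (a, b, c))"
    moreover have "(\<lambda>(a, b, c). T (a, b, c)) = T" by auto
    ultimately show "form_ext T f = 0" by metis
  qed simp
  finally show ?thesis .
qed

lemma D_slot2_funpow: "(D_slot2 D ^^ n) (pure3 a b c) = pure3 a ((D ^^ n) b) c"
  by (induction n) (simp_all add: D_slot2_def pure3_def lin_ext_single)

lemma D_slot3_funpow: "(D_slot3 D ^^ n) (pure3 a b c) = pure3 a b ((D ^^ n) c)"
  by (induction n) (simp_all add: D_slot3_def pure3_def lin_ext_single)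

text \<open>
  The value of \<open>T\<close> on \<open>\<Sum>\<^sub>n \<mu>\<^sup>n p\<^sub>n \<otimes> b \<otimes> c\<close> with \<open>\<mu>\<close> replaced by \<open>\<partial>\<close> acting on \<open>b\<close>.  In each of the three
  terms of \<open>[[r,r]]\<close> the bracket occupies one factor and \<open>\<mu>\<close> acts on another, so all three are
  instances with the arguments of \<open>T\<close> permuted.
\<close>

definition mu_eval ::
  "('r \<Rightarrow> 'r) \<Rightarrow> ('r \<Rightarrow> 'r \<Rightarrow> 'r \<Rightarrow> 'k::field) \<Rightarrow> 'r::zero poly \<Rightarrow> 'r \<Rightarrow> 'r \<Rightarrow> 'k" where
  "mu_eval D T p b c = (\<Sum>n\<le>degree p. T (coeff p n) ((D ^^ n) b) c)"

text \<open>
  The value of \<open>T\<close> on the summand of \<open>[[r,r]]\<close> for the pairs \<open>(x, y)\<close> and \<open>(x', y')\<close>.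
\<close>

definition bracket_form ::
  "('r \<Rightarrow> 'r) \<Rightarrow> ('r \<Rightarrow> 'r \<Rightarrow> 'r poly) \<Rightarrow> ('r \<Rightarrow> 'r \<Rightarrow> 'r \<Rightarrow> 'k::field) \<Rightarrow> 'r::zero \<Rightarrow> 'r \<Rightarrow> 'r \<Rightarrow> 'r \<Rightarrow> 'k"
  where "bracket_form D lb T x y x' y' =
      mu_eval D T (lb x x') y y'
    - mu_eval D (\<lambda>p b c. T c p b) (lb x' y) y' x
    - mu_eval D (\<lambda>p b c. T c b p) (lb y' y) x' x"

lemma form_ext_double_bracket:
  "form_ext (\<lambda>(a, b, c). T a b c) (double_bracket D lb xs) = pair_sum2 xs (bracket_form D lb T)"
  unfolding double_bracket_def form_ext_pair_sum form_ext_diff subst_mu_def form_ext_sum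
    D_slot2_funpow D_slot3_funpow form_ext_pure3
  by (simp add: bracket_form_def mu_eval_def)

text \<open>
  A fixed bound in place of the degree makes linearity in \<open>p\<close> visible.
\<close>

lemma mu_eval_bound:
  assumes "trilinear_form s T" "degree p \<le> m"
  shows "mu_eval D T p b c = (\<Sum>n\<le>m. T (coeff p n) ((D ^^ n) b) c)"
proof -
  have "T 0 b c = 0" for b c
    using assms(1) linear_0[of s "(*)" "\<lambda>a. T a b c"] by (simp add: trilinear_form_def)
  then show ?thesis
    unfolding mu_eval_def using assms(2)
    by (intro sum.mono_neutral_left) (auto simp: coeff_eq_0)
qed

lemma linear_mu_eval:
  assumes s: "vector_space s" and D: "Vector_Spaces.linear s s D" and T: "trilinear_form s T"
  shows "linear_form (R_scale s) (\<lambda>p. mu_eval D T p b c)"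
    and "linear_form s (\<lambda>b. mu_eval D T p b c)"
    and "linear_form s (\<lambda>c. mu_eval D T p b c)"
proof -
  have T': "linear_form s (\<lambda>a. T a b c)" "linear_form s (\<lambda>b. T a b c)" "linear_form s (\<lambda>c. T a b c)"
    for a b c using T by (simp_all add: trilinear_form_def)
  show "linear_form (R_scale s) (\<lambda>p. mu_eval D T p b c)"
    by (rule linear_of_degree_bound[OF s, where g = "\<lambda>m p. \<Sum>n\<le>m. T (coeff p n) ((D ^^ n) b) c",
          OF _ mu_eval_bound[OF T]])
       (intro linear_set_sum vector_space_R_scale s vector_space_mult
         linear_comp[OF linear_coeff[OF s] T'(1)])
  show "linear_form s (\<lambda>b. mu_eval D T p b c)"
    unfolding mu_eval_def
    by (intro linear_set_sum s vector_space_mult linear_comp[OF linear_funpow[OF s D] T'(2)])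
  show "linear_form s (\<lambda>c. mu_eval D T p b c)"
    unfolding mu_eval_def by (intro linear_set_sum s vector_space_mult T'(3))
qed

lemma bilinear_bracket_form:
  assumes s: "vector_space s" and D: "Vector_Spaces.linear s s D" and T: "trilinear_form s T"
    and lb: "\<And>v. Vector_Spaces.linear s (R_scale s) (\<lambda>u. lb u v)"
      "\<And>u. Vector_Spaces.linear s (R_scale s) (lb u)"
  shows "bilinear_form s (\<lambda>x y. bracket_form D lb T x y x' y')"
    and "bilinear_form s (bracket_form D lb T x y)"
proof -
  have T': "trilinear_form s (\<lambda>p b c. T c p b)" "trilinear_form s (\<lambda>p b c. T c b p)"
    using T by (simp_all add: trilinear_form_def)
  note mu = linear_mu_eval[OF s D T] linear_mu_eval[OF s D T'(1)] linear_mu_eval[OF s D T'(2)]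
  note hom = mu[THEN linear_add] mu[THEN linear_scale] lb[THEN linear_add] lb[THEN linear_scale]
  show "bilinear_form s (\<lambda>x y. bracket_form D lb T x y x' y')"
    "bilinear_form s (bracket_form D lb T x y)"
    using s vector_space_mult
    by (simp_all add: bilinear_form_def bracket_form_def Vector_Spaces.linear_iff hom)
       (simp_all add: algebra_simps)
qed


section \<open>The bracket of the Lie conformal algebra\<close>

context gd_algebra
begin

lemma vector_space_scale: "vector_space scale"
  using novikov.linear_left by (simp add: Vector_Spaces.linear_iff)

abbreviation "sc_R \<equiv> R_scale scale"
abbreviation "sc_R_lam \<equiv> R_scale sc_R"

lemmas vector_space_sc_R = vector_space_R_scale[OF vector_space_scale]
lemmas vector_space_sc_R_lam = vector_space_R_scale[OF vector_space_sc_R]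

lemma linear_lam_op: "Vector_Spaces.linear sc_R_lam sc_R_lam lam_op"
  using linear_R_del[OF vector_space_sc_R] by (simp add: lam_op_def R_del_def[abs_def])

lemma linear_gen_bracket:
  "Vector_Spaces.linear scale sc_R_lam (\<lambda>a. gen_bracket circ brk a b)"
  "Vector_Spaces.linear scale sc_R_lam (gen_bracket circ brk a)"
proof -
  note const = linear_const[OF vector_space_scale] linear_const[OF vector_space_sc_R]
  note mult = novikov.linear_left novikov.linear_right lie.linear_left lie.linear_right
  have star: "Vector_Spaces.linear scale scale (\<lambda>a. star circ a b)"
    "Vector_Spaces.linear scale scale (star circ a)" for a b
    unfolding star_def[abs_def] by (intro linear_plus mult)+
  note lin = const linear_R_del[OF vector_space_scale] linear_lam_op
  show "Vector_Spaces.linear scale sc_R_lam (\<lambda>a. gen_bracket circ brk a b)"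
    unfolding gen_bracket_def
    by (intro linear_plus linear_comp[OF linear_comp[OF linear_comp[OF mult(2) lin(1)] lin(3)] lin(2)]
      linear_comp[OF linear_comp[OF linear_comp[OF star(1) lin(1)] lin(2)] lin(4)]
      linear_comp[OF linear_comp[OF mult(3) lin(1)] lin(2)])
  show "Vector_Spaces.linear scale sc_R_lam (gen_bracket circ brk a)"
    unfolding gen_bracket_def[abs_def]
    by (intro linear_plus linear_comp[OF linear_comp[OF linear_comp[OF mult(1) lin(1)] lin(3)] lin(2)]
      linear_comp[OF linear_comp[OF linear_comp[OF star(2) lin(1)] lin(2)] lin(4)]
      linear_comp[OF linear_comp[OF mult(4) lin(1)] lin(2)])
qed

text \<open>
  On polynomials of bounded degree the bracket is a sum, over a fixed index set, of linear
  operators applied to brackets of coefficients.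
\<close>

lemma linear_R_bracket:
  "Vector_Spaces.linear sc_R sc_R_lam (\<lambda>u. R_bracket circ brk u v)"
  "Vector_Spaces.linear sc_R sc_R_lam (R_bracket circ brk u)"
proof -
  let ?t = "\<lambda>i j w. ((\<lambda>w. - lam_op w) ^^ i) (((\<lambda>w. lam_op w + del_op w) ^^ j) w)"
  have t: "Vector_Spaces.linear sc_R_lam sc_R_lam (?t i j)" for i j
    by (intro linear_comp[OF linear_funpow linear_funpow] vector_space_sc_R_lam linear_uminus
      linear_plus linear_lam_op linear_del_op vector_space_scale)
  note coeff = linear_coeff[OF vector_space_scale]
  show "Vector_Spaces.linear sc_R sc_R_lam (\<lambda>u. R_bracket circ brk u v)"
  proof (rule linear_of_degree_bound[OF vector_space_scale])
    show "R_bracket circ brk u v =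
        (\<Sum>i\<le>m. \<Sum>j\<le>degree v. ?t i j (gen_bracket circ brk (coeff u i) (coeff v j)))"
      if "degree u \<le> m" for u m
      using that by (intro R_bracket_upto) auto
    show "Vector_Spaces.linear sc_R sc_R_lam
        (\<lambda>u. \<Sum>i\<le>m. \<Sum>j\<le>degree v. ?t i j (gen_bracket circ brk (coeff u i) (coeff v j)))" for m
      by (intro linear_set_sum vector_space_sc_R vector_space_sc_R_lam
        linear_comp[OF linear_comp[OF coeff linear_gen_bracket(1)] t])
  qed
  show "Vector_Spaces.linear sc_R sc_R_lam (R_bracket circ brk u)"
  proof (rule linear_of_degree_bound[OF vector_space_scale])
    show "R_bracket circ brk u v =
        (\<Sum>i\<le>degree u. \<Sum>j\<le>n. ?t i j (gen_bracket circ brk (coeff u i) (coeff v j)))"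
      if "degree v \<le> n" for v n
      using that by (intro R_bracket_upto) auto
    show "Vector_Spaces.linear sc_R sc_R_lam
        (\<lambda>v. \<Sum>i\<le>degree u. \<Sum>j\<le>n. ?t i j (gen_bracket circ brk (coeff u i) (coeff v j)))" for n
      by (intro linear_set_sum vector_space_sc_R vector_space_sc_R_lam
        linear_comp[OF linear_comp[OF coeff linear_gen_bracket(2)] t])
  qed
qed

lemma mu_eval_R_bracket_const:
  assumes T: "trilinear_form sc_R T"
  shows "mu_eval R_del T (R_bracket circ brk [:a:] [:b:]) u v =
    T [:brk a b:] u v + T (R_del [:circ b a:]) u v + T [:star circ a b:] (R_del u) v"
proof -
  let ?p = "R_bracket circ brk [:a:] [:b:]"
  have p: "?p = [: [:brk a b:] + R_del [:circ b a:], [:star circ a b:] :]"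
    by (simp add: R_bracket_const gen_bracket_def lam_op_def add.commute)
  then have deg: "degree ?p \<le> 1" by simp
  have "T (x + y) u v = T x u v + T y u v" for x y
    using T by (simp add: trilinear_form_def Vector_Spaces.linear_iff)
  then show ?thesis
    unfolding mu_eval_bound[OF T deg] by (simp add: p)
qed

lemma brk_skew: "brk b a = - brk a b"
proof -
  have "brk (a + b) (a + b) = brk a a + brk b a + (brk a b + brk b b)"
    by (simp only: linear_add[OF lie.linear_left] linear_add[OF lie.linear_right])
  then have "brk b a + brk a b = 0" by (simp add: lie.alternating)
  then show ?thesis by (simp add: eq_neg_iff_add_eq_0)
qed

text \<open>
  The summand of \<open>[[r,r]]\<close> after every \<open>\<partial>\<close> in the first factor has been moved to the other two.
  Of \<open>x \<star> x' = x \<circ> x' + x' \<circ> x\<close>, the part \<open>x' \<circ> x\<close> cancels in the second factor, which is why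
  \<open>T2\<close> contains \<open>x \<circ> x'\<close> and \<open>T3\<close> contains \<open>x' \<circ> x\<close>.
\<close>

lemma bracket_form_const:
  assumes T: "trilinear_form sc_R T" and inv: "invariant_form R_del T"
  defines "T0 \<equiv> \<lambda>a b c. T [:a:] [:b:] [:c:]"
    and "T2 \<equiv> \<lambda>a b c. T [:a:] (R_del [:b:]) [:c:]"
    and "T3 \<equiv> \<lambda>a b c. T [:a:] [:b:] (R_del [:c:])"
  shows "bracket_form R_del (R_bracket circ brk) T [:x:] [:y:] [:x':] [:y':] =
      (T0 (brk x x') y y' + T0 x (brk y x') y' + T0 x x' (brk y y'))
    + (T2 (circ x x') y y' - T2 x (circ y x') y' - T2 x x' (star circ y y'))
    - (T3 x x' (circ y y') + T3 x (star circ y x') y' + T3 (circ x' x) y y')"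
proof -
  have T': "trilinear_form sc_R (\<lambda>p b c. T c p b)" "trilinear_form sc_R (\<lambda>p b c. T c b p)"
    using T by (simp_all add: trilinear_form_def)
  have T1: "T (R_del u) v w = - T u (R_del v) w - T u v (R_del w)" for u v w
    using inv[unfolded invariant_form_def, rule_format, of u v w] by (simp add: algebra_simps eq_neg_iff_add_eq_0)
  have lin: "T (u + u') v w = T u v w + T u' v w" "T u (v + v') w = T u v w + T u v' w"
    "T u v (w + w') = T u v w + T u v w'" for u u' v v' w w'
    using T by (simp_all add: trilinear_form_def Vector_Spaces.linear_iff)
  have neg: "T u (- v) w = - T u v w" "T u v (- w) = - T u v w" for u v w
    using T linear_neg[of sc_R "(*)" "\<lambda>v. T u v w"] linear_neg[of sc_R "(*)" "T u v"]
    by (simp_all add: trilinear_form_def)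
  have const: "[:a + b:] = [:a:] + [:b:]" "[:- a:] = - [:a:]" for a b :: 'a by simp_all
  show ?thesis
    unfolding bracket_form_def mu_eval_R_bracket_const[OF T] mu_eval_R_bracket_const[OF T'(1)]
      mu_eval_R_bracket_const[OF T'(2)] T0_def T2_def T3_def
      brk_skew[of x' y] brk_skew[of y' y] star_def const
    by (simp only: T1 lin neg) (simp add: algebra_simps)
qed


section \<open>The double bracket of a skew-symmetric tensor over A\<close>

text \<open>
  Exchanging the last two factors of \<open>N(r)\<close> puts \<open>x'\<close> and \<open>y'\<close> of its first two terms into the
  wrong places for a comparison with \<open>[[r,r]]\<close>; skew-symmetry in the pair \<open>(x', y')\<close> exchanges them
  back at the price of a sign.
\<close>

lemma N_form_flip:
  assumes skew: "skew_symmetric scale (tsum2 scale xs)" and T: "trilinear_form scale T"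
  shows "N_form circ (\<lambda>a b c. T a c b) xs =
    pair_sum2 xs (\<lambda>x y x' y'. T (circ x x') y y' - T x (circ y x') y' - T x x' (star circ y y'))"
proof -
  note T_hom = T[unfolded trilinear_form_def Vector_Spaces.linear_iff]
  note circ_hom = novikov.linear_left[unfolded Vector_Spaces.linear_iff]
    novikov.linear_right[unfolded Vector_Spaces.linear_iff]
  have "bilinear_form scale (\<lambda>x' y'. T x (circ y x') y')"
    "bilinear_form scale (\<lambda>x' y'. T x x' (star circ y y'))" for x y
    using T_hom circ_hom by (simp_all add: bilinear_form_def Vector_Spaces.linear_iff star_def algebra_simps)
  note pair_sum_skew[OF vector_space_scale skew this(1)] pair_sum_skew[OF vector_space_scale skew this(2)]
  then show ?thesis
    by (simp add: N_form_def pair_sum_add pair_sum_diff pair_sum_minus)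
qed

text \<open>
  The terms of \<open>bracket_form_const\<close> match \<open>C(r)\<close>, the flipped \<open>N(r)\<close> and \<open>N(r)\<close> up to interchanging
  the two summation indices in the term with \<open>x' \<circ> x\<close>.
\<close>

lemma double_bracket_form_const:
  assumes skew: "skew_symmetric scale (tsum2 scale xs)"
    and T: "trilinear_form sc_R T" and inv: "invariant_form R_del T"
  shows "pair_sum2 (map (\<lambda>(x, y). ([:x:], [:y:])) xs) (bracket_form R_del (R_bracket circ brk) T) =
      C_form brk (\<lambda>a b c. T [:a:] [:b:] [:c:]) xs
    + N_form circ (\<lambda>a b c. T [:a:] (R_del [:c:]) [:b:]) xs
    - N_form circ (\<lambda>a b c. T [:a:] [:b:] (R_del [:c:])) xs"
proof -
  let ?T2 = "\<lambda>a b c. T [:a:] (R_del [:b:]) [:c:]" and ?T3 = "\<lambda>a b c. T [:a:] [:b:] (R_del [:c:])"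
  note const = linear_const[OF vector_space_scale]
  have T2: "trilinear_form scale ?T2"
    by (intro trilinear_form_comp[OF _ _ _ T] const linear_comp[OF const linear_R_del] vector_space_scale)
  have swap: "pair_sum2 xs (\<lambda>x y x' y'. ?T3 (circ x' x) y y') = pair_sum2 xs (\<lambda>x y x' y'. ?T3 (circ x x') y' y)"
    by (rule pair_sum2_swap)
  have emb: "pair_sum2 (map (\<lambda>(x, y). ([:x:], [:y:])) xs) F =
      pair_sum2 xs (\<lambda>x y x' y'. F [:x:] [:y:] [:x':] [:y':])" for F :: "'a poly \<Rightarrow> 'a poly \<Rightarrow> 'a poly \<Rightarrow> 'a poly \<Rightarrow> 'k"
    by (simp add: split_def comp_def)
  show ?thesis
    unfolding emb bracket_form_const[OF T inv] N_form_flip[OF skew T2] N_form_def[of circ ?T3] C_form_def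
    by (simp add: pair_sum_add pair_sum_diff swap)
qed

end

theorem proposition3p18:
  fixes scale :: "'k::field_char_0 \<Rightarrow> 'a::ab_group_add \<Rightarrow> 'a"
    and circ brk :: "'a \<Rightarrow> 'a \<Rightarrow> 'a"
    and r :: "(('a \<times> 'a) \<Rightarrow>\<^sub>0 'k) set"
  assumes "gd_algebra scale circ brk"
    and "r \<in> tensor2 scale"
    and "skew_symmetric scale r"
  shows "ccybe (R_scale scale) R_del (R_bracket circ brk) (R_embed2 scale r)
     \<longleftrightarrow> gdybe scale circ brk r"
proof -
  interpret gd_algebra scale circ brk by fact
  let ?emb = "map (\<lambda>(x, y). ([:x:], [:y:])) :: ('a \<times> 'a) list \<Rightarrow> ('a poly \<times> 'a poly) list"
  let ?form = "\<lambda>T xs. pair_sum2 xs (bracket_form R_del (R_bracket circ brk) T)"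
  have ccybe_iff: "ccybe sc_R R_del (R_bracket circ brk) (R_embed2 scale r) \<longleftrightarrow>
      (\<exists>us. R_embed2 scale r = tsum2 sc_R us \<and>
        (\<forall>T. trilinear_form sc_R T \<and> invariant_form R_del T \<longrightarrow> ?form T us = 0))"
    unfolding ccybe_def congruent_0_mod_D_total_iff[OF vector_space_sc_R] form_ext_double_bracket ..
  show ?thesis
  proof
    assume "gdybe scale circ brk r"
    then obtain xs where xs: "r = tsum2 scale xs"
      and forms: "\<And>T. trilinear_form scale T \<Longrightarrow> N_form circ T xs = 0 \<and> C_form brk T xs = 0"
      unfolding gdybe_iff[OF vector_space_scale] by blast
    have "?form T (?emb xs) = 0" if T: "trilinear_form sc_R T" "invariant_form R_del T" for T
    proof -
      note const = linear_const[OF vector_space_scale]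
      note del_const = linear_comp[OF const linear_R_del[OF vector_space_scale]]
      have T': "trilinear_form sc_R (\<lambda>a b c. T a c b)" using T(1) by (simp add: trilinear_form_def)
      show ?thesis
        unfolding double_bracket_form_const[OF assms(3)[unfolded xs] T]
        using forms[OF trilinear_form_comp[OF const const const T(1)]]
          forms[OF trilinear_form_comp[OF const const del_const T']]
          forms[OF trilinear_form_comp[OF const const del_const T(1)]] by simp
    qed
    moreover have "R_embed2 scale r = tsum2 sc_R (?emb xs)"
      unfolding xs by (rule R_embed2_tsum2[OF vector_space_scale])
    ultimately show "ccybe sc_R R_del (R_bracket circ brk) (R_embed2 scale r)"
      unfolding ccybe_iff by blast
  next
    assume "ccybe sc_R R_del (R_bracket circ brk) (R_embed2 scale r)"
    then obtain us where us: "R_embed2 scale r = tsum2 sc_R us"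
      and forms: "\<And>T. trilinear_form sc_R T \<Longrightarrow> invariant_form R_del T \<Longrightarrow> ?form T us = 0"
      unfolding ccybe_iff by blast
    obtain xs where xs: "r = tsum2 scale xs"
      using tensor2_eq_tsum2[OF vector_space_scale assms(2)] .
    \<comment> \<open>\<open>us\<close> may contain elements outside \<open>A\<close>; it is replaced by a presentation over \<open>A\<close>\<close>
    have "tsum2 sc_R us = tsum2 sc_R (?emb xs)"
      using us by (simp add: xs R_embed2_tsum2[OF vector_space_scale])
    then have zero: "?form T (?emb xs) = 0" if "trilinear_form sc_R T" "invariant_form R_del T" for T
      using pair_sum2_cong_tsum2[OF vector_space_sc_R _
          bilinear_bracket_form[OF vector_space_sc_R linear_R_del[OF vector_space_scale] that(1)
            linear_R_bracket]]
        forms[OF that] by metis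
    have "N_form circ t xs = 0 \<and> C_form brk t xs = 0" if t: "trilinear_form scale t" for t
    proof
      note coeff = linear_coeff[OF vector_space_scale]
      have t0: "t 0 b c = 0" "t a 0 c = 0" "t a b 0 = 0" for a b c
        using t linear_0[of scale "(*)" "\<lambda>a. t a b c"] linear_0[of scale "(*)" "\<lambda>b. t a b c"]
          linear_0[of scale "(*)" "t a b"] by (simp_all add: trilinear_form_def)
      have N0: "N_form circ (\<lambda>_ _ _. 0) xs = (0 :: 'k)" by (simp add: N_form_def split_def)
      have C0: "C_form brk (\<lambda>_ _ _. 0) xs = (0 :: 'k)" by (simp add: C_form_def split_def)
      \<comment> \<open>the coefficient of \<open>1\<close>, i.e. \<open>\<partial>\<close> is set to zero in all factors\<close>
      let ?ev = "\<lambda>u v w. t (coeff u 0) (coeff v 0) (coeff w 0)"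
      have "trilinear_form sc_R ?ev" by (intro trilinear_form_comp[OF _ _ _ t] coeff)
      moreover have "invariant_form R_del ?ev" by (simp add: invariant_form_def R_del_def t0)
      ultimately show "C_form brk t xs = 0"
        using zero double_bracket_form_const[OF assms(3)[unfolded xs], of ?ev]
        by (simp add: R_del_def t0 N0)
      \<comment> \<open>the coefficient of \<open>\<partial>\<^sub>3\<close> after the substitution \<open>\<partial>\<^sub>1 = - \<partial>\<^sub>2 - \<partial>\<^sub>3\<close>\<close>
      let ?ev3 = "\<lambda>u v w. t (coeff u 0) (coeff v 0) (coeff w 1) - t (coeff u 1) (coeff v 0) (coeff w 0)"
      have "trilinear_form sc_R (\<lambda>u v w. t (coeff u i) (coeff v j) (coeff w k))" for i j k
        by (intro trilinear_form_comp[OF _ _ _ t] coeff)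
      then have "trilinear_form sc_R ?ev3"
        unfolding trilinear_form_def by (auto intro!: linear_minus)
      moreover have "invariant_form R_del ?ev3" by (simp add: invariant_form_def R_del_def t0)
      ultimately show "N_form circ t xs = 0"
        using zero double_bracket_form_const[OF assms(3)[unfolded xs], of ?ev3]
        by (simp add: R_del_def t0 N0 C0)
    qed
    then show "gdybe scale circ brk r"
      unfolding gdybe_iff[OF vector_space_scale] using xs by blast
  qed
qed

end
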